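(* For every integer $\ell\ge 2$, an optical priority queue with buffer $3\times 2^{\ell-1}-2$ can be constructed with a single $\left(\tfrac12(9\ell^2+39\ell)+8\right)\times\left(\tfrac12(9\ell^2+39\ell)+8\right)$ crossbar switch and $\tfrac92(\ell^2-\ell)+18$ fiber delay lines.
   Context: Time is slotted, packets have fixed size and one packet traverses a link in one slot. An $n\times n$ (optical) crossbar switch is a memoryless element with $n$ inputs and $n$ outputs that at each time slot connects inputs to outputs according to any permutation chosen by its routing policy, packets passing instantaneously. A fiber delay line (FDL) with delay $d$ (a nonnegative integer) has one input and one output; a packet entering at time $t$ exits at time $t+d$. An optical priority queue is a network built from crossbar switches and FDLs (here: one switch some of whose outputs are connected back to its inputs through FDLs, plus an external arrival input, a departure output and a loss output, with a controller) together with a routing policy, that is a priority queue with the stated buffer. Priority queue with buffer $B$: each arriving packet carries a unique priority; if at the beginning of time $t$ there are $k$ packets in the element (including the arriving one, if any) and packet $i$ has the $j$-th highest priority among them, its tag is $\tau_i(t)=j$. With $a(t),d(t),l(t)\in\{0,1\}$ the states of the arrival, departure and loss links, $c(t)\in\{0,1\}$ indicating a departure request and $q(t)$ the number of buffered packets, starting empty at time $0$, for all $t>0$: (P1) $q(t)=q(t-1)+a(t)-d(t)-l(t)$; (P2) $d(t)=1$ iff $c(t)=1$ and $q(t-1)+a(t)>0$; (P3) $l(t)=1$ iff $c(t)=0$, $q(t-1)=B$, $a(t)=1$; (P4) a departing packet $i$ at $t$ has $\tau_i(t)=1$; (P5) a lost packet $i$ at $t$ has $\tau_i(t)=B+1$.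 *)

theory Defs
  imports Main "HOL.Real"
begin

text \<open>An optical network consisting of ONE n x n crossbar switch (ports 0..n-1 on
  each side), an external arrival input, a departure output, a loss output, and
  fiber delay lines, each given as (switch output port, switch input port, delay):
  the FDL takes packets from the given switch output and feeds them back, after the
  delay, into the given switch input.\<close>

record onet =
  nports   :: nat
  arr_in   :: nat
  dep_out  :: nat
  loss_out :: nat
  fdls     :: "(nat \<times> nat \<times> nat) list"

definition fdl_out :: "onet \<Rightarrow> nat \<Rightarrow> nat" where
  "fdl_out net k = fst (fdls net ! k)"
definition fdl_in :: "onet \<Rightarrow> nat \<Rightarrow> nat" where
  "fdl_in net k = fst (snd (fdls net ! k))"
definition fdl_delay :: "onet \<Rightarrow> nat \<Rightarrow> nat" where
  "fdl_delay net k = snd (snd (fdls net ! k))"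

definition wf_net :: "onet \<Rightarrow> bool" where
  "wf_net net \<longleftrightarrow>
     arr_in net < nports net \<and> dep_out net < nports net \<and> loss_out net < nports net \<and>
     (\<forall>k < length (fdls net). fdl_out net k < nports net \<and> fdl_in net k < nports net) \<and>
     distinct (dep_out net # loss_out net # map fst (fdls net)) \<and>
     distinct (arr_in net # map (\<lambda>x. fst (snd x)) (fdls net))"

text \<open>Where a packet ends up within one slot when the switch uses connection
  pattern \<sigma> (input port \<mapsto> output port) and the packet is at input port p.
  Zero-delay lines are traversed instantaneously (with fuel to cut off cycles);
  a packet sent to an unused output (or trapped in a zero-delay cycle) is Dropped,
  i.e. it vanishes (which the priority-queue specification then forbids).\<close>

datatype dest = Dep | Loss | Line nat | Drop

fun route :: "nat \<Rightarrow> onet \<Rightarrow> (nat \<Rightarrow> nat) \<Rightarrow> nat \<Rightarrow> dest" where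
  "route 0 net \<sigma> p = Drop"
| "route (Suc f) net \<sigma> p =
     (if \<sigma> p = dep_out net then Dep
      else if \<sigma> p = loss_out net then Loss
      else if (\<exists>k < length (fdls net). fdl_out net k = \<sigma> p) then
        (let k = (THE k. k < length (fdls net) \<and> fdl_out net k = \<sigma> p) in
          if 0 < fdl_delay net k then Line k else route f net \<sigma> (fdl_in net k))
      else Drop)"

text \<open>Packets are identified by their (unique, real-valued) priorities; larger value
  = higher priority. A state is the set of triples (priority, FDL index, exit time)
  of packets currently inside FDLs.\<close>

type_synonym pstate = "(real \<times> nat \<times> nat) set"

definition inputs_at :: "onet \<Rightarrow> real option \<Rightarrow> pstate \<Rightarrow> nat \<Rightarrow> (real \<times> nat) set" where
  "inputs_at net arr S t =
     {(x, arr_in net) | x. arr = Some x} \<union> {(x, fdl_in net k) | x k. (x, k, t) \<in> S}"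

definition routed_at :: "onet \<Rightarrow> (nat \<Rightarrow> nat) \<Rightarrow> real option \<Rightarrow> pstate \<Rightarrow> nat \<Rightarrow> (real \<times> dest) set" where
  "routed_at net \<sigma> arr S t =
     (\<lambda>(x, p). (x, route (Suc (nports net)) net \<sigma> p)) ` inputs_at net arr S t"

definition next_state :: "onet \<Rightarrow> (nat \<Rightarrow> nat) \<Rightarrow> real option \<Rightarrow> pstate \<Rightarrow> nat \<Rightarrow> pstate" where
  "next_state net \<sigma> arr S t =
     {(x, k, e) \<in> S. t < e} \<union>
     {(x, k, t + fdl_delay net k) | x k. (x, Line k) \<in> routed_at net \<sigma> arr S t}"

text \<open>A routing policy (controller) chooses the switch permutation at time t from the
  arrival sequence a (a t = Some x: a packet of priority x arrives at time t) and the
  departure-request sequence c.\<close>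

type_synonym policy = "(nat \<Rightarrow> real option) \<Rightarrow> (nat \<Rightarrow> bool) \<Rightarrow> nat \<Rightarrow> nat \<Rightarrow> nat"

fun sim :: "onet \<Rightarrow> policy \<Rightarrow> (nat \<Rightarrow> real option) \<Rightarrow> (nat \<Rightarrow> bool) \<Rightarrow> nat \<Rightarrow> pstate" where
  "sim net R a c 0 = {}"
| "sim net R a c (Suc t) = next_state net (R a c (Suc t)) (a (Suc t)) (sim net R a c t) (Suc t)"

definition routed :: "onet \<Rightarrow> policy \<Rightarrow> (nat \<Rightarrow> real option) \<Rightarrow> (nat \<Rightarrow> bool) \<Rightarrow> nat \<Rightarrow> (real \<times> dest) set" where
  "routed net R a c t = routed_at net (R a c t) (a t) (sim net R a c (t - 1)) t"

definition departed :: "onet \<Rightarrow> policy \<Rightarrow> (nat \<Rightarrow> real option) \<Rightarrow> (nat \<Rightarrow> bool) \<Rightarrow> nat \<Rightarrow> real set" where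
  "departed net R a c t = {x. (x, Dep) \<in> routed net R a c t}"

definition lost :: "onet \<Rightarrow> policy \<Rightarrow> (nat \<Rightarrow> real option) \<Rightarrow> (nat \<Rightarrow> bool) \<Rightarrow> nat \<Rightarrow> real set" where
  "lost net R a c t = {x. (x, Loss) \<in> routed net R a c t}"

definition qlen :: "onet \<Rightarrow> policy \<Rightarrow> (nat \<Rightarrow> real option) \<Rightarrow> (nat \<Rightarrow> bool) \<Rightarrow> nat \<Rightarrow> nat" where
  "qlen net R a c t = card (sim net R a c t)"

definition present :: "onet \<Rightarrow> policy \<Rightarrow> (nat \<Rightarrow> real option) \<Rightarrow> (nat \<Rightarrow> bool) \<Rightarrow> nat \<Rightarrow> real set" where
  "present net R a c t = {x | x k e. (x, k, e) \<in> sim net R a c (t - 1)} \<union> set_option (a t)"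

definition tag :: "onet \<Rightarrow> policy \<Rightarrow> (nat \<Rightarrow> real option) \<Rightarrow> (nat \<Rightarrow> bool) \<Rightarrow> nat \<Rightarrow> real \<Rightarrow> nat" where
  "tag net R a c t x = card {y \<in> present net R a c t. x \<le> y}"

definition ind :: "bool \<Rightarrow> nat" where
  "ind b = (if b then 1 else 0)"

definition is_priority_queue :: "onet \<Rightarrow> policy \<Rightarrow> nat \<Rightarrow> bool" where
  "is_priority_queue net R B \<longleftrightarrow>
    (\<forall>a c. (\<forall>s t x. 0 < s \<longrightarrow> 0 < t \<longrightarrow> a s = Some x \<longrightarrow> a t = Some x \<longrightarrow> s = t) \<longrightarrow>
      (\<forall>t > 0.
        let q = qlen net R a c; ar = ind (a t \<noteq> None);
            dd = card (departed net R a c t); ll = card (lost net R a c t) in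
        int (q t) = int (q (t - 1)) + int ar - int dd - int ll \<and>
        dd = ind (c t \<and> q (t - 1) + ar > 0) \<and>
        ll = ind (\<not> c t \<and> q (t - 1) = B \<and> ar = 1) \<and>
        (\<forall>x \<in> departed net R a c t. tag net R a c t x = 1) \<and>
        (\<forall>x \<in> lost net R a c t. tag net R a c t x = B + 1)))"

definition valid_policy :: "onet \<Rightarrow> policy \<Rightarrow> bool" where
  "valid_policy net R \<longleftrightarrow>
    (\<forall>a c t. bij_betw (R a c t) {..<nports net} {..<nports net}) \<and>
    (\<forall>a a' c c' t. (\<forall>s \<le> t. a s = a' s \<and> c s = c' s) \<longrightarrow> R a c t = R a' c' t)"

end

theory Submission
  imports Defs "HOL-Computational_Algebra.Primes"
begin

text \<open>The ranks \<open>1, \<dots>, B\<close> are split into levels of geometrically growing size according to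
  their distance from the two ends. A level of maximal delay \<open>D\<close> is a FIFO queue releasing up to
  ten packets per slot back to the switch, which sends each of them to the level of its current
  rank. A rank changes by at most one per slot, so a delay of at most \<open>D\<close> moves a packet by at
  most one level, packets of rank \<open>1\<close> or \<open>B\<close> are always at the switch in the next slot, and at most
  \<open>3 * 10 + 1\<close> packets enter a level in a slot. Only two new packets per slot reach the ranks of
  a level, so it holds at most \<open>2 * (4 * D + 1) + 2 * (D - 1) = 10 * D\<close> packets, which is why the
  FIFO delay is indeed at most \<open>D\<close>. The FIFO delays are realised by lines of length
  \<open>d * 4 ^ j\<close>, visited in the order of the base-4 digits of the remaining delay, lowest first.\<close>

section \<open>Ranks in an ideal priority queue\<close>

text \<open>The radix and the number of channels are tied together. With growth factor
  \<open>b\<close> in place of 4 and \<open>C\<close> channels, the occupancy bound reads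
  \<open>2 * (b * D + 1) + 2 * (D - 1) = 2 * (b + 1) * D\<close>, so a delay of at most
  \<open>D\<close> calls for \<open>C = 2 * (b + 1)\<close>. Packets competing for one line are at
  least \<open>b * C * b ^ j\<close> reservation numbers apart, while the window in which both were
  numbered hands out at most \<open>(3 * C + 1) * b ^ j\<close>; this is a contradiction only if
  \<open>b * C\<close> is at least \<open>3 * C + 1\<close>, and 4 is the smallest such radix. The
  obstacle throughout is that a packet on a line cannot be recalled and that a line accepts one
  packet per slot. Fixing the release slot on entry to a level turns this into a statement about
  numbers alone. The maximal delays \<open>1, 5, 21, ...\<close> exhaust the occupancy bound
  exactly, and their top base-4 digit is 1. About \<open>15 * G ^ 2\<close> lines result, with
  \<open>l\<close> about \<open>2 * G\<close>, which stays below the allowed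
  \<open>9 / 2 * l ^ 2\<close>.\<close>

definition rank :: "real set \<Rightarrow> real \<Rightarrow> nat" where
  "rank Q x = card {y \<in> Q. x \<le> y}"

definition offered :: "real set \<Rightarrow> real option \<Rightarrow> real set" where
  "offered Q ar = Q \<union> set_option ar"

definition served :: "real set \<Rightarrow> real option \<Rightarrow> bool \<Rightarrow> real set" where
  "served Q ar cc = (if cc \<and> offered Q ar \<noteq> {} then {Max (offered Q ar)} else {})"

text \<open>As long as at most \<open>B\<close> packets are stored, having \<open>B + 1\<close> on
  offer means a full buffer together with an arrival, which is the condition for a loss.\<close>

definition dropped :: "nat \<Rightarrow> real set \<Rightarrow> real option \<Rightarrow> bool \<Rightarrow> real set" where
  "dropped B Q ar cc =
     (if \<not> cc \<and> card (offered Q ar) = Suc B then {Min (offered Q ar)} else {})"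

definition kept :: "nat \<Rightarrow> real set \<Rightarrow> real option \<Rightarrow> bool \<Rightarrow> real set" where
  "kept B Q ar cc = offered Q ar - served Q ar cc - dropped B Q ar cc"

lemma rank_less:
  assumes "finite Q" "x \<in> Q" "x < y"
  shows "rank Q y < rank Q x"
proof -
  have "{z \<in> Q. y \<le> z} \<subset> {z \<in> Q. x \<le> z}" using assms by force
  then show ?thesis unfolding rank_def using assms(1) by (intro psubset_card_mono) auto
qed

lemma inj_on_rank: "finite Q \<Longrightarrow> inj_on (rank Q) Q"
  by (intro linorder_inj_onI) (metis rank_less less_irrefl_nat, auto)

lemma rank_pos: "finite Q \<Longrightarrow> x \<in> Q \<Longrightarrow> 1 \<le> rank Q x"
  unfolding rank_def by (auto simp: Suc_le_eq card_gt_0_iff)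

lemma rank_le_card: "finite Q \<Longrightarrow> rank Q x \<le> card Q"
  unfolding rank_def by (intro card_mono) auto

lemma finite_offered [simp]: "finite Q \<Longrightarrow> finite (offered Q ar)"
  by (simp add: offered_def)

lemma finite_kept: "finite Q \<Longrightarrow> finite (kept B Q ar cc)"
  by (simp add: kept_def)

lemma served_subset: "finite Q \<Longrightarrow> served Q ar cc \<subseteq> offered Q ar"
  by (simp add: served_def)

lemma dropped_subset:
  assumes "finite Q" shows "dropped B Q ar cc \<subseteq> offered Q ar"
proof (cases "offered Q ar = {}")
  case False
  then show ?thesis using Min_in[of "offered Q ar"] assms by (simp add: dropped_def)
qed (simp add: dropped_def)

lemma served_dropped_disjoint: "served Q ar cc \<inter> dropped B Q ar cc = {}"
  by (auto simp: served_def dropped_def)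

lemma card_offered_le: "finite Q \<Longrightarrow> card (offered Q ar) \<le> Suc (card Q)"
  unfolding offered_def by (cases ar) (simp_all add: card_insert_if)

lemma card_kept:
  assumes "finite Q"
  shows "card (kept B Q ar cc) + card (served Q ar cc) + card (dropped B Q ar cc) = card (offered Q ar)"
proof -
  have f: "finite (served Q ar cc)" "finite (dropped B Q ar cc)"
    by (simp_all add: served_def dropped_def)
  have "card (served Q ar cc) \<le> card (offered Q ar)"
    using assms by (intro card_mono served_subset) auto
  moreover have "card (dropped B Q ar cc) \<le> card (offered Q ar - served Q ar cc)"
    using assms served_dropped_disjoint dropped_subset by (intro card_mono) (simp, blast)
  moreover have "dropped B Q ar cc \<subseteq> offered Q ar - served Q ar cc"
    using dropped_subset[OF assms] served_dropped_disjoint by blast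
  ultimately show ?thesis
    unfolding kept_def using f served_subset[OF assms, of ar cc]
    by (simp add: card_Diff_subset)
qed

lemma card_kept_le:
  assumes "finite Q" "card Q \<le> B" shows "card (kept B Q ar cc) \<le> B"
proof (cases "card (offered Q ar) = Suc B")
  case True
  then have "offered Q ar \<noteq> {}" by auto
  then have "card (served Q ar cc) + card (dropped B Q ar cc) = 1"
    using True by (simp add: served_def dropped_def)
  then show ?thesis using card_kept[OF assms(1), of B ar cc] True by simp
next
  case False
  then show ?thesis using card_kept[OF assms(1), of B ar cc] card_offered_le[OF assms(1), of ar] assms(2) by simp
qed

text \<open>The arrival's contribution to a rank. It is 1 for the arriving packet itself, so that
  the rank balance below covers old packets and the arrival alike.\<close>

definition ahead :: "real option \<Rightarrow> real \<Rightarrow> nat" where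
  "ahead ar x = (case ar of None \<Rightarrow> 0 | Some y \<Rightarrow> if x \<le> y then 1 else 0)"

lemma ahead_antimono: "x \<le> y \<Longrightarrow> ahead ar y \<le> ahead ar x"
  unfolding ahead_def by (auto split: option.splits)

lemma ahead_le: "ahead ar x \<le> 1"
  unfolding ahead_def by (auto split: option.splits)

lemma ahead_Some: "ahead (Some x) x = 1"
  unfolding ahead_def by simp

text \<open>A served packet lies above every survivor and a dropped one below, so a service lowers
  each surviving rank by one and a drop changes none.\<close>

lemma rank_kept:
  assumes "finite Q" "set_option ar \<inter> Q = {}" "x \<in> kept B Q ar cc"
  shows "rank (kept B Q ar cc) x + card (served Q ar cc) = rank Q x + ahead ar x"
proof -
  have nd: "y < x" if "y \<in> dropped B Q ar cc" for y
  proof -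
    have "y = Min (offered Q ar)" using that by (simp add: dropped_def split: if_splits)
    then have "y \<le> x" using assms by (auto simp: kept_def)
    moreover have "y \<noteq> x" using assms(3) that by (auto simp: kept_def)
    ultimately show ?thesis by simp
  qed
  have ns: "x < y" if "y \<in> served Q ar cc" for y
  proof -
    have "y = Max (offered Q ar)" using that by (simp add: served_def split: if_splits)
    then have "x \<le> y" using assms by (auto simp: kept_def)
    moreover have "y \<noteq> x" using assms(3) that by (auto simp: kept_def)
    ultimately show ?thesis by simp
  qed
  have "card {y \<in> offered Q ar. x \<le> y} = card ({y \<in> kept B Q ar cc. x \<le> y} \<union> served Q ar cc)"
    using nd ns served_subset[OF assms(1), of ar cc]
    by (intro arg_cong[where f = card])
      (auto simp: kept_def dest: less_imp_le leD)
  also have "\<dots> = rank (kept B Q ar cc) x + card (served Q ar cc)"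
    unfolding rank_def using assms(1)
    by (intro card_Un_disjoint) (auto simp: kept_def served_def)
  finally have 1: "card {y \<in> offered Q ar. x \<le> y} = rank (kept B Q ar cc) x + card (served Q ar cc)" .
  have "card {y \<in> offered Q ar. x \<le> y} = card ({y \<in> Q. x \<le> y} \<union> {y \<in> set_option ar. x \<le> y})"
    by (intro arg_cong[where f = card]) (auto simp: offered_def)
  also have "\<dots> = rank Q x + card {y \<in> set_option ar. x \<le> y}"
    unfolding rank_def using assms by (intro card_Un_disjoint) (cases ar; auto)+
  also have "card {y \<in> set_option ar. x \<le> y} = ahead ar x"
  proof (cases ar)
    case (Some y)
    then have "{y \<in> set_option ar. x \<le> y} = (if x \<le> y then {y} else {})" by auto
    then show ?thesis using Some by (simp add: ahead_def)
  qed (simp add: ahead_def)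
  finally show ?thesis using 1 by simp
qed

lemma card_served_le: "card (served Q ar cc) \<le> 1"
  by (simp add: served_def)

text \<open>A packet can newly enter a rank interval only by crossing one of its ends, or by arriving
  inside it; a single slot admits one such event, even if it has both an arrival and a departure.\<close>

lemma card_joining_le:
  fixes B :: nat and cc :: bool
  assumes fin: "finite Q" and new: "set_option ar \<inter> Q = {}"
    and convex: "\<And>p q r. p \<in> I \<Longrightarrow> r \<in> I \<Longrightarrow> p \<le> q \<Longrightarrow> q \<le> r \<Longrightarrow> q \<in> I"
  defines "Q' \<equiv> kept B Q ar cc"
  shows "card ({x \<in> Q'. rank Q' x \<in> I} - {x \<in> Q. rank Q x \<in> I}) \<le> 1" (is "card ?D \<le> 1")
proof -
  have fin': "finite Q'" using fin by (simp add: Q'_def finite_kept)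
  \<comment> \<open>Here \<open>x\<close> has the larger new rank, and by convexity the old rank of
    a joiner lies outside the span from \<open>rank Q' z\<close> to \<open>rank Q' x\<close>. Ranks
    move by at most one, so an old \<open>x\<close> must come from above the span: a service, with
    no arrival ahead of \<open>x\<close>. Then \<open>z\<close> is old as well and comes from one
    rank higher, inside the span. If \<open>x\<close> is the arrival, \<open>z\<close> keeps its
    rank or comes from one rank higher, again inside the span.\<close>
  have contra: False if x: "x \<in> ?D" and z: "z \<in> ?D" and "x < z" for x z
  proof -
    define s where "s = card (served Q ar cc)"
    have s: "s \<le> 1" unfolding s_def by (rule card_served_le)
    have rx: "rank Q' x + s = rank Q x + ahead ar x" and rz: "rank Q' z + s = rank Q z + ahead ar z"
      using rank_kept[OF fin new, of _ B cc] x z by (auto simp: Q'_def s_def)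
    have lt: "rank Q' z < rank Q' x" using rank_less[OF fin' _ \<open>x < z\<close>] x by simp
    have m: "ahead ar z \<le> ahead ar x" "ahead ar x \<le> 1" "ahead ar z \<le> 1"
      using ahead_antimono[of x z ar] ahead_le \<open>x < z\<close> by auto
    have I: "rank Q' x \<in> I" "rank Q' z \<in> I" using x z by auto
    have mem: "x \<in> Q'" "z \<in> Q'" using x z by auto
    have arr: "ar = Some u" if "u \<in> Q'" "u \<notin> Q" for u
      using that by (simp add: Q'_def kept_def offered_def)
    have a: "ahead ar u = 1" if "u \<in> Q'" "u \<notin> Q" for u
      using arr[OF that] by (simp add: ahead_Some)
    have cx: "rank Q x < rank Q' z \<or> rank Q' x < rank Q x" if "x \<in> Q"
    proof (rule ccontr)
      assume "\<not> ?thesis"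
      then have "rank Q x \<in> I" by (intro convex[OF I(2) I(1)]) simp_all
      then show False using x that by simp
    qed
    have cz: "rank Q z < rank Q' z \<or> rank Q' x < rank Q z" if "z \<in> Q"
    proof (rule ccontr)
      assume "\<not> ?thesis"
      then have "rank Q z \<in> I" by (intro convex[OF I(2) I(1)]) simp_all
      then show False using z that by simp
    qed
    have uniq: "x \<in> Q \<or> z \<in> Q"
      using arr[OF mem(1)] arr[OF mem(2)] \<open>x < z\<close> by force
    have ax: "ahead ar z = 0" if "x \<notin> Q"
      using arr[OF mem(1) that] \<open>x < z\<close> by (simp add: ahead_def)
    show False
    proof (cases "x \<in> Q")
      case xQ: True
      show False
      proof (cases "z \<in> Q")
        case True
        show False using cx[OF xQ] cz[OF True] s rx rz lt m by linarith
      next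
        case False
        show False using cx[OF xQ] a[OF mem(2) False] s rx rz lt m by linarith
      qed
    next
      case False
      then have "z \<in> Q" using uniq by simp
      then show False using cz a[OF mem(1) False] ax[OF False] s rx rz lt m by linarith
    qed
  qed
  have "finite ?D" using fin' by simp
  then show ?thesis
    unfolding One_nat_def card_le_Suc0_iff_eq[OF \<open>finite ?D\<close>]
  proof (intro ballI)
    fix u v assume "u \<in> ?D" "v \<in> ?D"
    then show "u = v" using contra[of u v] contra[of v u] by (cases u v rule: linorder_cases) simp_all
  qed
qed

section \<open>Levels\<close>

fun dmax :: "nat \<Rightarrow> nat" where
  "dmax 0 = 1"
| "dmax (Suc i) = 4 * dmax i + 1"

text \<open>Level \<open>i\<close> has the depths from \<open>thr i\<close> up to, but excluding,
  \<open>thr (Suc i)\<close>. Its width is the longest delay of level \<open>i + 1\<close>, so a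
  packet of that level cannot drift across level \<open>i\<close> during one stay.\<close>

fun thr :: "nat \<Rightarrow> nat" where
  "thr 0 = 1"
| "thr (Suc i) = thr i + dmax (Suc i)"

text \<open>Only packets of rank \<open>1\<close> or \<open>B\<close> may have to leave in the next slot, so the
  urgency of a packet is governed by the distance of its rank from the nearer end of \<open>{0..B + 1}\<close>.\<close>

definition depth :: "nat \<Rightarrow> nat \<Rightarrow> nat" where
  "depth B r = min r (B + 1 - r)"

lemma depth_left: "2 * r \<le> B + 1 \<Longrightarrow> depth B r = r"
  and depth_right: "B + 1 < 2 * r \<Longrightarrow> depth B r = B + 1 - r"
  by (simp_all add: depth_def)

definition lev :: "nat \<Rightarrow> nat \<Rightarrow> nat" where
  "lev B r = (LEAST i. depth B r < thr (Suc i))"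

lemma dmax_pos: "1 \<le> dmax i"
  by (induction i) auto

lemma dmax_closed_form: "3 * dmax i + 1 = 4 ^ Suc i"
  by (induction i) auto

lemma dmax_less: "dmax i < 2 * 4 ^ i"
  using dmax_closed_form[of i] by simp

lemma dmax_le_thr: "dmax i \<le> thr i"
  by (cases i) auto

lemma thr_mono: "i \<le> j \<Longrightarrow> thr i \<le> thr j"
  by (rule lift_Suc_mono_le[of thr]) auto

lemma less_thr: "i < thr i"
  by (induction i) auto

lemma depth_less_thr_lev: "depth B r < thr (Suc (lev B r))"
  unfolding lev_def
proof (rule LeastI)
  show "depth B r < thr (Suc (depth B r))" using less_thr[of "Suc (depth B r)"] by linarith
qed

lemma lev_le: "depth B r < thr (Suc i) \<Longrightarrow> lev B r \<le> i"
  unfolding lev_def by (rule Least_le)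

lemma thr_lev_le_depth:
  assumes "1 \<le> r" "r \<le> B" shows "thr (lev B r) \<le> depth B r"
proof (cases "lev B r")
  case 0
  then show ?thesis using assms by (simp add: depth_def)
next
  case (Suc i)
  then have "\<not> depth B r < thr (Suc i)" using lev_le[of B r i] by auto
  then show ?thesis using Suc by simp
qed

lemma lev_mono: "depth B r \<le> depth B r' \<Longrightarrow> lev B r \<le> lev B r'"
  using lev_le depth_less_thr_lev le_less_trans by metis

lemma depth_diff: "r \<le> r' + k \<Longrightarrow> r' \<le> r + k \<Longrightarrow> depth B r \<le> depth B r' + k"
  by (simp add: depth_def)

text \<open>Downwards the estimate is tight: from depth \<open>thr m + dmax (Suc m)\<close>, a drift
  of \<open>dmax (Suc m)\<close> still leaves depth \<open>thr m\<close>. Upwards the next level is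
  wider than the drift.\<close>

lemma lev_neighbour:
  assumes "1 \<le> r" "r \<le> B" "r \<le> r' + dmax (lev B r)" "r' \<le> r + dmax (lev B r)"
  shows "lev B r' \<le> lev B r + 1" "lev B r \<le> lev B r' + 1"
proof -
  let ?i = "lev B r"
  have "depth B r' \<le> depth B r + dmax ?i" using assms by (intro depth_diff) auto
  also have "\<dots> < thr (Suc ?i) + dmax ?i" using depth_less_thr_lev[of B r] by linarith
  also have "\<dots> \<le> thr (Suc (?i + 1))" by simp
  finally show "lev B r' \<le> lev B r + 1" by (rule lev_le)
  show "lev B r \<le> lev B r' + 1"
  proof (rule ccontr)
    assume "\<not> lev B r \<le> lev B r' + 1"
    then obtain m where m: "?i = Suc m" "Suc (lev B r') \<le> m" by (cases ?i) auto
    have "depth B r' < thr m"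
      using depth_less_thr_lev[of B r'] thr_mono[OF m(2)] by simp
    moreover have "thr m + dmax ?i \<le> depth B r"
      using thr_lev_le_depth[OF assms(1,2)] m(1) by simp
    moreover have "depth B r \<le> depth B r' + dmax ?i" using assms by (intro depth_diff) auto
    ultimately show False by simp
  qed
qed

text \<open>\<open>depth\<close> folds the ranks at the middle, so a level consists of two rank
  intervals. They are kept apart because the bound of one joining packet per slot concerns a single
  interval; this is the origin of the factors 2 in the occupancy bound.\<close>

definition left_ranks :: "nat \<Rightarrow> nat \<Rightarrow> nat set" where
  "left_ranks B i = {r. 1 \<le> r \<and> r \<le> B \<and> lev B r = i \<and> 2 * r \<le> B + 1}"

definition right_ranks :: "nat \<Rightarrow> nat \<Rightarrow> nat set" where
  "right_ranks B i = {r. 1 \<le> r \<and> r \<le> B \<and> lev B r = i \<and> B + 1 < 2 * r}"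

lemma left_ranks_convex:
  "p \<in> left_ranks B i \<Longrightarrow> r \<in> left_ranks B i \<Longrightarrow> p \<le> q \<Longrightarrow> q \<le> r \<Longrightarrow> q \<in> left_ranks B i"
  using lev_mono[of B p q] lev_mono[of B q r] by (simp add: left_ranks_def depth_left)

lemma right_ranks_convex:
  "p \<in> right_ranks B i \<Longrightarrow> r \<in> right_ranks B i \<Longrightarrow> p \<le> q \<Longrightarrow> q \<le> r \<Longrightarrow> q \<in> right_ranks B i"
  using lev_mono[of B q p] lev_mono[of B r q] by (simp add: right_ranks_def depth_right diff_le_mono2)

lemma card_left_ranks: "card (left_ranks B i) \<le> dmax (Suc i)"
proof -
  have "left_ranks B i \<subseteq> {thr i..<thr (Suc i)}"
  proof
    fix r assume r: "r \<in> left_ranks B i"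
    then have "r = depth B r" by (simp add: left_ranks_def depth_left)
    then show "r \<in> {thr i..<thr (Suc i)}"
      using r thr_lev_le_depth[of r B] depth_less_thr_lev[of B r] by (simp add: left_ranks_def)
  qed
  then have "card (left_ranks B i) \<le> card {thr i..<thr (Suc i)}" by (intro card_mono) auto
  then show ?thesis by simp
qed

lemma card_right_ranks: "card (right_ranks B i) \<le> dmax (Suc i)"
proof -
  have "(\<lambda>r. B + 1 - r) ` right_ranks B i \<subseteq> {thr i..<thr (Suc i)}"
  proof
    fix u assume "u \<in> (\<lambda>r. B + 1 - r) ` right_ranks B i"
    then obtain r where r: "u = B + 1 - r" "1 \<le> r" "r \<le> B" "lev B r = i" "B + 1 < 2 * r"
      by (auto simp: right_ranks_def)
    then have "u = depth B r" by (simp add: depth_right)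
    then show "u \<in> {thr i..<thr (Suc i)}"
      using thr_lev_le_depth[of r B] depth_less_thr_lev[of B r] r by simp
  qed
  then have "card ((\<lambda>r. B + 1 - r) ` right_ranks B i) \<le> card {thr i..<thr (Suc i)}"
    by (intro card_mono) auto
  moreover have "inj_on (\<lambda>r. B + 1 - r) (right_ranks B i)"
    by (auto simp: inj_on_def right_ranks_def)
  ultimately show ?thesis by (simp add: card_image)
qed

lemma card_rank_preimage_le:
  assumes "finite Q" "finite I" shows "card {x \<in> Q. rank Q x \<in> I} \<le> card I"
  by (rule card_inj_on_le[of "rank Q"])
    (use assms inj_on_rank in \<open>auto intro: inj_on_subset\<close>)

lemma level_packets_split:
  assumes "finite Q" "card Q \<le> B"
  shows "{x \<in> Q. lev B (rank Q x) = i} =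
    {x \<in> Q. rank Q x \<in> left_ranks B i} \<union> {x \<in> Q. rank Q x \<in> right_ranks B i}"
  using rank_pos[OF assms(1)] le_trans[OF rank_le_card[OF assms(1)] assms(2)]
  by (auto simp: left_ranks_def right_ranks_def)

lemma card_level_packets:
  assumes "finite Q" "card Q \<le> B"
  shows "card {x \<in> Q. lev B (rank Q x) = i} \<le> 2 * dmax (Suc i)"
proof -
  have "card {x \<in> Q. rank Q x \<in> left_ranks B i} \<le> dmax (Suc i)"
    by (rule le_trans[OF card_rank_preimage_le card_left_ranks])
      (use assms in \<open>auto simp: left_ranks_def\<close>)
  moreover have "card {x \<in> Q. rank Q x \<in> right_ranks B i} \<le> dmax (Suc i)"
    by (rule le_trans[OF card_rank_preimage_le card_right_ranks])
      (use assms in \<open>auto simp: right_ranks_def\<close>)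
  ultimately show ?thesis
    unfolding level_packets_split[OF assms] by (intro le_trans[OF card_Un_le]) simp
qed

lemma card_level_joining:
  fixes cc :: bool
  assumes "finite Q" "card Q \<le> B" "set_option ar \<inter> Q = {}"
  defines "Q' \<equiv> kept B Q ar cc"
  shows "card ({x \<in> Q'. lev B (rank Q' x) = i} - {x \<in> Q. lev B (rank Q x) = i}) \<le> 2"
proof -
  let ?L = "\<lambda>Q. {x \<in> Q. rank Q x \<in> left_ranks B i}"
  let ?R = "\<lambda>Q. {x \<in> Q. rank Q x \<in> right_ranks B i}"
  have f: "finite Q'" "card Q' \<le> B"
    using assms(1,2) by (auto simp: Q'_def finite_kept card_kept_le)
  have "card (?L Q' - ?L Q) \<le> 1"
    unfolding Q'_def by (rule card_joining_le[OF assms(1,3)]) (rule left_ranks_convex)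
  moreover have "card (?R Q' - ?R Q) \<le> 1"
    unfolding Q'_def by (rule card_joining_le[OF assms(1,3)]) (rule right_ranks_convex)
  moreover have "{x \<in> Q'. lev B (rank Q' x) = i} - {x \<in> Q. lev B (rank Q x) = i}
      \<subseteq> (?L Q' - ?L Q) \<union> (?R Q' - ?R Q)"
    unfolding level_packets_split[OF assms(1,2)] level_packets_split[OF f] by blast
  then have "card ({x \<in> Q'. lev B (rank Q' x) = i} - {x \<in> Q. lev B (rank Q x) = i})
      \<le> card ((?L Q' - ?L Q) \<union> (?R Q' - ?R Q))"
    using f by (intro card_mono) auto
  ultimately show ?thesis
    using card_Un_le[of "?L Q' - ?L Q" "?R Q' - ?R Q"] by linarith
qed

section \<open>Scheduling\<close>

type_synonym key = "nat \<times> nat \<times> nat \<times> nat"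

text \<open>A delay line \<open>(i, j, d, c)\<close> serves channel \<open>c\<close> of level \<open>i\<close>.\<close>

definition delay :: "key \<Rightarrow> nat" where
  "delay k = (case k of (i, j, d, c) \<Rightarrow> d * 4 ^ j)"

text \<open>At the top position \<open>i\<close> only the digit 1 is provided, since delays of level
  \<open>i\<close> stay below \<open>2 * 4 ^ i\<close>.\<close>

definition keys :: "nat \<Rightarrow> key set" where
  "keys G = {(i, j, d, c). i \<le> G \<and> c < 10 \<and> (j < i \<and> d \<in> {1, 2, 3} \<or> j = i \<and> d = 1)}"

text \<open>A packet with remaining delay \<open>r\<close> next traverses the line given by the lowest nonzero
  base-4 digit of \<open>r\<close>.\<close>

definition hop :: "nat \<Rightarrow> nat \<Rightarrow> nat \<Rightarrow> key" where
  "hop i n r = (i, multiplicity 4 r, r div 4 ^ multiplicity 4 r mod 4, n mod 10)"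

text \<open>Dividing \<open>r\<close> by the largest power of 4 in it leaves a number prime to no
  carry: its residue modulo 4 is the nonzero digit \<open>d\<close>, and \<open>q\<close> collects
  the higher digits. Maximality of \<open>j\<close> later allows comparison with any power of 4
  known to divide the remaining delay.\<close>

lemma hopE:
  assumes "0 < r"
  obtains j d q where "hop i n r = (i, j, d, n mod 10)" "d \<in> {1, 2, 3}"
    "r = d * 4 ^ j + 4 ^ Suc j * q" "\<And>J. 4 ^ J dvd r \<Longrightarrow> J \<le> j"
proof -
  define j where "j = multiplicity 4 r"
  have j: "4 ^ J dvd r \<longleftrightarrow> J \<le> j" for J
    unfolding j_def using assms by (intro power_dvd_iff_le_multiplicity) auto
  then obtain q where q: "r = 4 ^ j * q" by (metis dvdE order_refl)
  have "\<not> 4 dvd q"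
  proof
    assume "4 dvd q"
    then have "4 ^ j * 4 dvd 4 ^ j * q" by (intro mult_dvd_mono dvd_refl)
    then have "4 ^ Suc j dvd r" unfolding q by (simp only: power_Suc2)
    then show False using j[of "Suc j"] by simp
  qed
  then have "q mod 4 \<noteq> 0" by (simp add: dvd_eq_mod_eq_0)
  then have d: "q mod 4 \<in> {1, 2, 3}" using mod_less_divisor[of 4 q] by auto
  have "hop i n r = (i, j, q mod 4, n mod 10)"
    unfolding hop_def j_def[symmetric] by (simp add: q)
  moreover have "r = q mod 4 * 4 ^ j + 4 ^ Suc j * (q div 4)"
  proof -
    have "r = 4 ^ j * (4 * (q div 4) + q mod 4)" unfolding q by (simp only: mult_div_mod_eq)
    then show ?thesis by (simp only: distrib_left power_Suc mult_ac add_ac)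
  qed
  ultimately show ?thesis using that d j by blast
qed

lemma delay_hop_bounds:
  assumes "0 < r"
  shows "0 < delay (hop i n r)" "delay (hop i n r) \<le> r"
proof -
  obtain j d q where h: "hop i n r = (i, j, d, n mod 10)" "d \<in> {1, 2, 3}"
    "r = d * 4 ^ j + 4 ^ Suc j * q"
    using hopE[OF assms] by metis
  have "delay (hop i n r) = d * 4 ^ j" by (simp add: h(1) delay_def)
  moreover have "0 < d * 4 ^ j" using h(2) by auto
  ultimately show "0 < delay (hop i n r)" "delay (hop i n r) \<le> r" using h(3) by linarith+
qed

lemma hop_in_keys:
  assumes "0 < r" "r \<le> dmax i" "i \<le> G"
  shows "hop i n r \<in> keys G"
proof -
  obtain j d q where h: "hop i n r = (i, j, d, n mod 10)" and d: "d \<in> {1, 2, 3}"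
    and r: "r = d * 4 ^ j + 4 ^ Suc j * q"
    using hopE[OF assms(1)] by metis
  have lt: "d * 4 ^ j < 2 * 4 ^ i" using dmax_less[of i] assms(2) r by linarith
  have "j \<le> i"
  proof (rule ccontr)
    assume "\<not> j \<le> i"
    then have "(4::nat) ^ Suc i \<le> 4 ^ j" by (intro power_increasing) auto
    moreover have "1 * 4 ^ j \<le> d * 4 ^ j" using d by (intro mult_right_mono) auto
    ultimately show False using lt by simp
  qed
  moreover have "d = 1" if "j = i"
  proof -
    have "d < 2" using lt unfolding that by simp
    then show ?thesis using d by auto
  qed
  ultimately show ?thesis using d assms(3) unfolding h keys_def by auto
qed

text \<open>A packet entering level \<open>i\<close> gets a reservation number \<open>n\<close> and is released from that level
  in slot \<open>n div 10\<close>.\<close>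

record qstate =
  stored :: "real set"
  grp :: "real \<Rightarrow> nat"
  idx :: "real \<Rightarrow> nat"
  entry :: "real \<Rightarrow> nat"
  due :: "real \<Rightarrow> nat"
  line :: "real \<Rightarrow> key"
  nxt :: "nat \<Rightarrow> nat"

text \<open>Arrivals and packets whose stay ends now; these are assigned a new level and number. The
  remaining packets at the switch only change lines within their level.\<close>

definition fresh :: "qstate \<Rightarrow> nat \<Rightarrow> real \<Rightarrow> bool" where
  "fresh g t x \<longleftrightarrow> x \<notin> stored g \<or> idx g x div 10 = t"

definition at_switch :: "qstate \<Rightarrow> nat \<Rightarrow> real \<Rightarrow> bool" where
  "at_switch g t x \<longleftrightarrow> x \<notin> stored g \<or> due g x = t"

definition newcomers :: "nat \<Rightarrow> nat \<Rightarrow> real option \<Rightarrow> bool \<Rightarrow> qstate \<Rightarrow> nat \<Rightarrow> real set" where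
  "newcomers B t ar cc g i =
     {x \<in> kept B (stored g) ar cc. fresh g t x \<and> lev B (rank (kept B (stored g) ar cc) x) = i}"

text \<open>Numbering starts no lower than \<open>10 * Suc t\<close>, because a packet entering a
  level in slot \<open>t\<close> can be released in slot \<open>t + 1\<close> at the earliest. The
  simultaneous newcomers of a level get consecutive numbers.\<close>

definition step :: "nat \<Rightarrow> nat \<Rightarrow> real option \<Rightarrow> bool \<Rightarrow> qstate \<Rightarrow> qstate" where
  "step B t ar cc g =
    (let Q = kept B (stored g) ar cc;
         i = \<lambda>x. if fresh g t x then lev B (rank Q x) else grp g x;
         s = \<lambda>i. max (nxt g i) (10 * Suc t);
         n = \<lambda>x. if fresh g t x then s (i x) + card {y \<in> newcomers B t ar cc g (i x). y < x}
                 else idx g x;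
         h = \<lambda>x. if at_switch g t x then hop (i x) (n x) (n x div 10 - t) else line g x
     in \<lparr>stored = Q, grp = i, idx = n,
         entry = (\<lambda>x. if fresh g t x then t else entry g x),
         due = (\<lambda>x. if at_switch g t x then t + delay (h x) else due g x),
         line = h,
         nxt = (\<lambda>i. s i + card (newcomers B t ar cc g i))\<rparr>)"

text \<open>The counters start at 10, the smallest number with release slot 1.\<close>

primrec run :: "nat \<Rightarrow> (nat \<Rightarrow> real option) \<Rightarrow> (nat \<Rightarrow> bool) \<Rightarrow> nat \<Rightarrow> qstate" where
  "run B a c 0 = \<lparr>stored = {}, grp = \<lambda>_. 0, idx = \<lambda>_. 0, entry = \<lambda>_. 0, due = \<lambda>_. 0,
     line = \<lambda>_. (0, 0, 0, 0), nxt = \<lambda>_. 10\<rparr>"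
| "run B a c (Suc t) = step B (Suc t) (a (Suc t)) (c (Suc t)) (run B a c t)"

lemma run_cong: "(\<And>s. s \<le> t \<Longrightarrow> a s = a' s \<and> c s = c' s) \<Longrightarrow> run B a c t = run B a' c' t"
proof (induction t)
  case (Suc t)
  have "run B a c t = run B a' c' t" using Suc.prems by (intro Suc.IH) simp
  then show ?case using Suc.prems[of "Suc t"] by simp
qed simp

text \<open>Injectivity makes the reservation numbers of simultaneous newcomers distinct; the
  description of the image leaves no gap between them.\<close>

lemma
  fixes F :: "'a::linorder set"
  assumes "finite F"
  shows inj_on_card_less: "inj_on (\<lambda>x. card {y \<in> F. y < x}) F"
    and card_less_image: "(\<lambda>x. card {y \<in> F. y < x}) ` F = {..<card F}"
proof -
  have less: "card {y \<in> F. y < x} < card {y \<in> F. y < z}" if "x \<in> F" "x < z" for x z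
  proof -
    have "{y \<in> F. y < x} \<subset> {y \<in> F. y < z}" using that by force
    then show ?thesis using assms by (intro psubset_card_mono) auto
  qed
  show inj: "inj_on (\<lambda>x. card {y \<in> F. y < x}) F"
  proof (rule inj_onI)
    fix x z assume "x \<in> F" "z \<in> F" "card {y \<in> F. y < x} = card {y \<in> F. y < z}"
    then show "x = z" using less[of x z] less[of z x] by (cases x z rule: linorder_cases) simp_all
  qed
  have "(\<lambda>x. card {y \<in> F. y < x}) ` F \<subseteq> {..<card F}"
  proof (intro image_subsetI, unfold lessThan_iff, intro psubset_card_mono assms)
    fix x assume "x \<in> F"
    then show "{y \<in> F. y < x} \<subset> F" by blast
  qed
  then show "(\<lambda>x. card {y \<in> F. y < x}) ` F = {..<card F}"
    by (intro card_subset_eq) (simp_all add: card_image[OF inj])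
qed

lemma le_div_10: "k \<le> n div 10 \<longleftrightarrow> 10 * k \<le> (n::nat)"
  by (simp add: less_eq_div_iff_mult_less_eq mult.commute)

section \<open>Runs of the schedule on a fixed input\<close>

locale pq_run =
  fixes B G :: nat and a :: "nat \<Rightarrow> real option" and c :: "nat \<Rightarrow> bool"
  assumes unique: "\<And>s t x. 0 < s \<Longrightarrow> 0 < t \<Longrightarrow> a s = Some x \<Longrightarrow> a t = Some x \<Longrightarrow> s = t"
    and B_le: "B \<le> 2 * (thr (Suc G) - 1)"
begin

abbreviation "Q t \<equiv> stored (run B a c t)"
abbreviation "gr t \<equiv> grp (run B a c t)"
abbreviation "ix t \<equiv> idx (run B a c t)"
abbreviation "en t \<equiv> entry (run B a c t)"
abbreviation "du t \<equiv> due (run B a c t)"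
abbreviation "li t \<equiv> line (run B a c t)"
abbreviation "nx t \<equiv> nxt (run B a c t)"
abbreviation "rl t x \<equiv> ix t x div 10"
abbreviation "fr t \<equiv> fresh (run B a c t) (Suc t)"
abbreviation "sw t \<equiv> at_switch (run B a c t) (Suc t)"
abbreviation "F t \<equiv> newcomers B (Suc t) (a (Suc t)) (c (Suc t)) (run B a c t)"
abbreviation "base t i \<equiv> max (nx t i) (10 * Suc (Suc t))"

lemma Q_Suc: "Q (Suc t) = kept B (Q t) (a (Suc t)) (c (Suc t))"
  by (simp add: step_def Let_def)

lemma gr_Suc: "gr (Suc t) x = (if fr t x then lev B (rank (Q (Suc t)) x) else gr t x)"
  by (simp add: step_def Let_def)

lemma en_Suc: "en (Suc t) x = (if fr t x then Suc t else en t x)"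
  by (simp add: step_def Let_def)

lemma ix_Suc: "ix (Suc t) x =
    (if fr t x then base t (gr (Suc t) x) + card {y \<in> F t (gr (Suc t) x). y < x} else ix t x)"
  by (simp add: step_def Let_def)

lemma li_Suc: "li (Suc t) x =
    (if sw t x then hop (gr (Suc t) x) (ix (Suc t) x) (rl (Suc t) x - Suc t) else li t x)"
  by (simp add: step_def Let_def)

lemma du_Suc: "du (Suc t) x = (if sw t x then Suc t + delay (li (Suc t) x) else du t x)"
  by (simp add: step_def Let_def)

lemma nx_Suc: "nx (Suc t) i = base t i + card (F t i)"
  by (simp add: step_def Let_def)

lemma F_eq: "F t i = {x \<in> Q (Suc t). fr t x \<and> lev B (rank (Q (Suc t)) x) = i}"
  unfolding newcomers_def Q_Suc ..

declare run.simps(2) [simp del]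

lemma finite_Q [simp]: "finite (Q t)" and card_Q_le: "card (Q t) \<le> B"
proof -
  have "finite (Q t) \<and> card (Q t) \<le> B"
    by (induction t) (auto simp: Q_Suc finite_kept card_kept_le)
  then show "finite (Q t)" "card (Q t) \<le> B" by auto
qed

lemma finite_F [simp]: "finite (F t i)"
  by (simp add: F_eq)

lemma Q_arrived: "x \<in> Q t \<Longrightarrow> \<exists>s. 0 < s \<and> s \<le> t \<and> a s = Some x"
proof (induction t)
  case (Suc t)
  then have "x \<in> Q t \<or> a (Suc t) = Some x" by (auto simp: Q_Suc kept_def offered_def)
  then show ?case using Suc.IH le_Suc_eq by blast
qed simp

lemma arrival_new: "set_option (a (Suc t)) \<inter> Q t = {}"
proof (rule ccontr)
  assume "\<not> ?thesis"
  then obtain x where x: "a (Suc t) = Some x" "x \<in> Q t" by auto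
  then obtain s where "0 < s" "s \<le> t" "a s = Some x" using Q_arrived by blast
  then show False using unique[of s "Suc t" x] x by simp
qed

lemma rank_bounds: "x \<in> Q t \<Longrightarrow> 1 \<le> rank (Q t) x \<and> rank (Q t) x \<le> B"
  using rank_pos[of "Q t" x] rank_le_card[of "Q t" x] card_Q_le[of t] by auto

lemma rank_Suc:
  assumes "x \<in> Q (Suc t)"
  shows "rank (Q (Suc t)) x \<le> rank (Q t) x + 1" "rank (Q t) x \<le> rank (Q (Suc t)) x + 1"
  using rank_kept[OF finite_Q arrival_new, of x B t "c (Suc t)"] assms
    ahead_le[of "a (Suc t)" x] card_served_le[of "Q t" "a (Suc t)" "c (Suc t)"]
  unfolding Q_Suc by linarith+

lemma rank_drift:
  assumes "s \<le> t" "\<And>\<tau>. s \<le> \<tau> \<Longrightarrow> \<tau> \<le> t \<Longrightarrow> x \<in> Q \<tau>"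
  shows "rank (Q t) x \<le> rank (Q s) x + (t - s) \<and> rank (Q s) x \<le> rank (Q t) x + (t - s)"
  using assms
proof (induction t rule: dec_induct)
  case (step n)
  have "x \<in> Q (Suc n)" using step by simp
  moreover have "rank (Q n) x \<le> rank (Q s) x + (n - s) \<and> rank (Q s) x \<le> rank (Q n) x + (n - s)"
    using step by simp
  ultimately show ?case using rank_Suc[of x n] step.hyps by linarith
qed simp

text \<open>No depth exceeds half of \<open>B + 1\<close>, and \<open>B_le\<close> places that below
  the end of level \<open>G\<close>.\<close>

lemma lev_rank_le: "x \<in> Q t \<Longrightarrow> lev B (rank (Q t) x) \<le> G"
proof (rule lev_le)
  assume "x \<in> Q t"
  then show "depth B (rank (Q t) x) < thr (Suc G)"
    using rank_bounds[of x t] B_le less_thr[of "Suc G"] by (simp add: depth_def)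
qed

definition level_set :: "nat \<Rightarrow> nat \<Rightarrow> real set" where
  "level_set t i = {x \<in> Q t. lev B (rank (Q t) x) = i}"

text \<open>The first slot of the window contributes both intervals in full, every further slot at
  most one new packet per interval.\<close>

lemma card_level_history: "card (\<Union>\<tau>\<in>{s..s + m}. level_set \<tau> i) \<le> 2 * dmax (Suc i) + 2 * m"
proof (induction m)
  case 0
  then show ?case using card_level_packets[OF finite_Q card_Q_le, of s i] by (simp add: level_set_def)
next
  case (Suc m)
  let ?U = "\<Union>\<tau>\<in>{s..s + m}. level_set \<tau> i" and ?D = "level_set (Suc (s + m)) i - level_set (s + m) i"
  have fin: "finite ?U" "finite ?D" by (auto simp: level_set_def)
  have "(\<Union>\<tau>\<in>{s..s + Suc m}. level_set \<tau> i) \<subseteq> ?U \<union> ?D"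
  proof
    fix x assume "x \<in> (\<Union>\<tau>\<in>{s..s + Suc m}. level_set \<tau> i)"
    then obtain \<tau> where \<tau>: "s \<le> \<tau>" "\<tau> \<le> s + Suc m" "x \<in> level_set \<tau> i" by auto
    show "x \<in> ?U \<union> ?D"
    proof (cases "\<tau> \<le> s + m")
      case False
      then have "\<tau> = Suc (s + m)" using \<tau> by simp
      then show ?thesis using \<tau> by (cases "x \<in> level_set (s + m) i") auto
    qed (use \<tau> in auto)
  qed
  then have "card (\<Union>\<tau>\<in>{s..s + Suc m}. level_set \<tau> i) \<le> card (?U \<union> ?D)"
    using fin by (intro card_mono) auto
  also have "\<dots> \<le> card ?U + card ?D" by (rule card_Un_le)
  also have "card ?D \<le> 2"
    using card_level_joining[OF finite_Q card_Q_le arrival_new, of "s + m" "c (Suc (s + m))" i]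
    unfolding level_set_def Q_Suc .
  finally show ?case using Suc.IH by simp
qed

section \<open>The invariant of the schedule\<close>

definition on_time :: "nat \<Rightarrow> bool" where
  "on_time t \<longleftrightarrow> (\<forall>x \<in> Q t. t < du t x \<and> du t x \<le> rl t x)"

text \<open>The level recorded for a packet is that of its rank on entry; the current rank may have
  drifted to another level.\<close>

definition tracked :: "nat \<Rightarrow> bool" where
  "tracked t \<longleftrightarrow> (\<forall>x \<in> Q t. en t x \<le> t \<and> rl t x \<le> en t x + dmax (gr t x) \<and>
     (\<forall>\<tau>. en t x \<le> \<tau> \<and> \<tau> \<le> t \<longrightarrow> x \<in> Q \<tau>) \<and> gr t x = lev B (rank (Q (en t x)) x))"

text \<open>Low digits come first: once all digits of the remaining delay below the \<open>J\<close>-th are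
  zero, fewer than \<open>4 ^ J\<close> slots have passed since the entry into the level.\<close>

definition aligned :: "nat \<Rightarrow> bool" where
  "aligned t \<longleftrightarrow> (\<forall>x \<in> Q t. \<exists>J. 4 ^ J dvd rl t x - du t x \<and> du t x < en t x + 4 ^ J)"

text \<open>Packets may share a line as long as they leave it in different slots. The bound on
  \<open>du\<close> ensures that a packet already on a line leaves it before any packet sent there
  later.\<close>

definition lines_ok :: "nat \<Rightarrow> bool" where
  "lines_ok t \<longleftrightarrow> (\<forall>x \<in> Q t. li t x \<in> keys G \<and> du t x \<le> t + delay (li t x)) \<and>
     (\<forall>x \<in> Q t. \<forall>y \<in> Q t. li t x = li t y \<longrightarrow> du t x = du t y \<longrightarrow> x = y)"

text \<open>Differences of numbers are bounded by 31 per slot of difference in entry. As subtraction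
  is truncated, the last clause also forces the lower number to have been assigned no later than the
  higher one.\<close>

definition fifo :: "nat \<Rightarrow> bool" where
  "fifo t \<longleftrightarrow>
     (\<forall>x \<in> Q t. ix t x < nx t (gr t x) \<and> nx t (gr t x) \<le> ix t x + 31 * (Suc t - en t x)) \<and>
     (\<forall>x \<in> Q t. \<forall>y \<in> Q t. gr t x = gr t y \<longrightarrow> ix t x = ix t y \<longrightarrow> x = y) \<and>
     (\<forall>x \<in> Q t. \<forall>y \<in> Q t. gr t x = gr t y \<longrightarrow> ix t x < ix t y \<longrightarrow>
        ix t y < ix t x + 31 * (Suc (en t y) - en t x))"

text \<open>Every unexpired number below the counter is held by a stored packet, so a bound on the
  occupancy of a level bounds its counter and hence the waiting time.\<close>

definition gapless :: "nat \<Rightarrow> bool" where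
  "gapless t \<longleftrightarrow> (\<forall>i. 10 * Suc t \<le> nx t i \<and>
     {10 * Suc t..<nx t i} \<subseteq> ix t ` {x \<in> Q t. gr t x = i})"

definition invariant :: "nat \<Rightarrow> bool" where
  "invariant t \<longleftrightarrow> on_time t \<and> tracked t \<and> aligned t \<and> lines_ok t \<and> fifo t \<and> gapless t"

lemma invariant_0: "invariant 0"
  by (auto simp: invariant_def on_time_def tracked_def aligned_def lines_ok_def fifo_def gapless_def)

section \<open>Preservation of the invariant in one slot\<close>

context
  fixes t :: nat
  assumes invariant: "invariant t"
begin

lemma dueD: "x \<in> Q t \<Longrightarrow> t < du t x \<and> du t x \<le> rl t x"
  using invariant by (simp add: invariant_def on_time_def)

lemma trackedD:
  assumes "x \<in> Q t"
  shows "en t x \<le> t" "rl t x \<le> en t x + dmax (gr t x)"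
    "\<And>\<tau>. en t x \<le> \<tau> \<Longrightarrow> \<tau> \<le> t \<Longrightarrow> x \<in> Q \<tau>" "gr t x = lev B (rank (Q (en t x)) x)"
  using invariant assms by (auto simp: invariant_def tracked_def)

lemma gr_le: "x \<in> Q t \<Longrightarrow> gr t x \<le> G"
  using trackedD[of x] lev_rank_le by auto

text \<open>The packet entered level \<open>i\<close> at depth at least \<open>thr i\<close>, hence
  at least \<open>dmax i\<close>, and depth changes by at most one per slot. Reaching depth 1 takes
  \<open>dmax i - 1\<close> slots or more, after which at most one slot of the stay is left.\<close>

lemma urgent_released:
  assumes "x \<in> Q t" "depth B (rank (Q t) x) \<le> 1"
  shows "rl t x = Suc t"
proof (rule ccontr)
  assume "rl t x \<noteq> Suc t"
  then have late: "Suc (Suc t) \<le> rl t x" using dueD[OF assms(1)] by linarith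
  let ?s = "en t x"
  have xs: "x \<in> Q ?s" using trackedD[OF assms(1)] by blast
  have dr: "rank (Q t) x \<le> rank (Q ?s) x + (t - ?s) \<and> rank (Q ?s) x \<le> rank (Q t) x + (t - ?s)"
    using trackedD[OF assms(1)] by (intro rank_drift) auto
  have "depth B (rank (Q ?s) x) \<le> depth B (rank (Q t) x) + (t - ?s)"
    using dr by (intro depth_diff) auto
  moreover have "thr (gr t x) \<le> depth B (rank (Q ?s) x)"
    using trackedD(4)[OF assms(1)] thr_lev_le_depth rank_bounds[OF xs] by simp
  ultimately show False
    using assms(2) trackedD(1,2)[OF assms(1)] late dmax_le_thr[of "gr t x"] by linarith
qed

text \<open>A stored packet is served only at rank 1. It is dropped only at rank \<open>B\<close>,
  since a drop requires a full buffer. Both ranks have depth at most 1.\<close>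

lemma removed_released:
  assumes "x \<in> Q t" "x \<notin> Q (Suc t)"
  shows "rl t x = Suc t"
proof (rule urgent_released[OF assms(1)])
  let ?P = "offered (Q t) (a (Suc t))"
  have xP: "x \<in> ?P" using assms(1) by (simp add: offered_def)
  have "x \<in> served (Q t) (a (Suc t)) (c (Suc t)) \<or> x \<in> dropped B (Q t) (a (Suc t)) (c (Suc t))"
    using assms xP unfolding Q_Suc kept_def by blast
  then have "rank (Q t) x = 1 \<or> rank (Q t) x = B"
  proof
    assume "x \<in> served (Q t) (a (Suc t)) (c (Suc t))"
    then have "x = Max ?P" by (simp add: served_def split: if_splits)
    then have "y \<le> x" if "y \<in> Q t" for y using that by (simp add: offered_def)
    then have "{y \<in> Q t. x \<le> y} = {x}" using assms(1) by force
    then show ?thesis by (simp add: rank_def)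
  next
    assume "x \<in> dropped B (Q t) (a (Suc t)) (c (Suc t))"
    then have x: "x = Min ?P" and cP: "card ?P = Suc B" by (simp_all add: dropped_def split: if_splits)
    then have "x \<le> y" if "y \<in> Q t" for y using that by (simp add: offered_def)
    then have "{y \<in> Q t. x \<le> y} = Q t" by auto
    moreover have "card (Q t) = B"
      using card_offered_le[OF finite_Q, of t "a (Suc t)"] cP card_Q_le[of t] by simp
    ultimately show ?thesis by (simp add: rank_def)
  qed
  then show "depth B (rank (Q t) x) \<le> 1" by (auto simp: depth_def)
qed

lemma released_due: "x \<in> Q t \<Longrightarrow> rl t x = Suc t \<Longrightarrow> du t x = Suc t"
  using dueD[of x] by simp

lemma fresh_sw: "fr t x \<Longrightarrow> sw t x"
  using released_due[of x] by (auto simp: fresh_def at_switch_def)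

lemma removed_sw: "x \<in> offered (Q t) (a (Suc t)) \<Longrightarrow> x \<notin> Q (Suc t) \<Longrightarrow> sw t x"
  using removed_released[of x] released_due[of x] by (auto simp: at_switch_def)

lemma not_fresh:
  assumes "\<not> fr t x" shows "x \<in> Q t" "Suc (Suc t) \<le> rl t x"
proof -
  show "x \<in> Q t" using assms by (simp add: fresh_def)
  then show "Suc (Suc t) \<le> rl t x" using assms dueD[of x] by (auto simp: fresh_def)
qed

lemma ix_inj: "x \<in> Q t \<Longrightarrow> y \<in> Q t \<Longrightarrow> gr t x = gr t y \<Longrightarrow> ix t x = ix t y \<Longrightarrow> x = y"
  using invariant by (auto simp: invariant_def fifo_def)

lemma card_released: "card {x \<in> Q t. gr t x = j \<and> rl t x = Suc t} \<le> 10"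
proof -
  have "card {x \<in> Q t. gr t x = j \<and> rl t x = Suc t} \<le> card {10 * Suc t..<10 * Suc (Suc t)}"
  proof (rule card_inj_on_le)
    show "inj_on (ix t) {x \<in> Q t. gr t x = j \<and> rl t x = Suc t}"
      by (rule inj_onI) (use ix_inj in simp)
  qed auto
  then show ?thesis by simp
qed

lemma card_F: "card (F t i) \<le> 31"
proof -
  let ?R = "\<lambda>j. {x \<in> Q t. gr t x = j \<and> rl t x = Suc t}"
  have "F t i \<subseteq> ?R (i - 1) \<union> ?R i \<union> ?R (Suc i) \<union> set_option (a (Suc t))"
  proof
    fix x assume "x \<in> F t i"
    then have x: "x \<in> Q (Suc t)" "fr t x" "lev B (rank (Q (Suc t)) x) = i" by (auto simp: F_eq)
    show "x \<in> ?R (i - 1) \<union> ?R i \<union> ?R (Suc i) \<union> set_option (a (Suc t))"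
    proof (cases "x \<in> Q t")
      case False
      then show ?thesis using x(1) by (auto simp: Q_Suc kept_def offered_def)
    next
      case True
      let ?s = "en t x"
      have rel: "rl t x = Suc t" using True x(2) by (simp add: fresh_def)
      have xs: "x \<in> Q ?s" using trackedD[OF True] by blast
      have "rank (Q t) x \<le> rank (Q ?s) x + (t - ?s) \<and> rank (Q ?s) x \<le> rank (Q t) x + (t - ?s)"
        using trackedD[OF True] by (intro rank_drift) auto
      \<comment> \<open>The new level is read off after the slot, which adds one step of drift; the
        total is still at most the length of the stay, \<open>Suc t - en t x\<close>.\<close>
      then have dr: "rank (Q (Suc t)) x \<le> rank (Q ?s) x + dmax (gr t x)"
          "rank (Q ?s) x \<le> rank (Q (Suc t)) x + dmax (gr t x)"
        using rank_Suc[OF x(1)] trackedD(1,2)[OF True] rel by linarith+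
      have "i \<le> gr t x + 1" "gr t x \<le> i + 1"
        using lev_neighbour[of "rank (Q ?s) x" B "rank (Q (Suc t)) x"] rank_bounds[OF xs] dr
          x(3) trackedD(4)[OF True] by auto
      then have "gr t x = i - 1 \<or> gr t x = i \<or> gr t x = Suc i" by linarith
      then show ?thesis using True rel by blast
    qed
  qed
  then have "card (F t i) \<le> card (?R (i - 1) \<union> ?R i \<union> ?R (Suc i) \<union> set_option (a (Suc t)))"
    by (intro card_mono) auto
  also have "\<dots> \<le> card (?R (i - 1)) + card (?R i) + card (?R (Suc i)) + card (set_option (a (Suc t)))"
    by (intro le_trans[OF card_Un_le] add_mono order_refl)
  also have "\<dots> \<le> 10 + 10 + 10 + 1"
    by (intro add_mono card_released) (cases "a (Suc t)", auto)
  finally show ?thesis by simp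
qed

lemma in_F: "x \<in> Q (Suc t) \<Longrightarrow> fr t x \<Longrightarrow> x \<in> F t (gr (Suc t) x)"
  by (simp add: F_eq gr_Suc)

lemma fresh_ix:
  assumes "x \<in> Q (Suc t)" "fr t x"
  shows "base t (gr (Suc t) x) \<le> ix (Suc t) x" "ix (Suc t) x < nx (Suc t) (gr (Suc t) x)"
proof -
  let ?F = "F t (gr (Suc t) x)"
  have "card {y \<in> ?F. y < x} \<in> (\<lambda>x. card {y \<in> ?F. y < x}) ` ?F"
    using in_F[OF assms] by (rule imageI)
  then have "card {y \<in> ?F. y < x} < card ?F"
    unfolding card_less_image[OF finite_F] by simp
  then show "base t (gr (Suc t) x) \<le> ix (Suc t) x" "ix (Suc t) x < nx (Suc t) (gr (Suc t) x)"
    using assms(2) by (simp_all add: ix_Suc nx_Suc)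
qed

lemma old_ix:
  assumes "\<not> fr t x"
  shows "ix (Suc t) x < nx t (gr (Suc t) x)"
    "nx t (gr (Suc t) x) \<le> ix (Suc t) x + 31 * (Suc t - en t x)"
    "10 * Suc (Suc t) \<le> ix (Suc t) x"
proof -
  have x: "x \<in> Q t" "Suc (Suc t) \<le> rl t x" using not_fresh[OF assms] by auto
  have e: "ix (Suc t) x = ix t x" "gr (Suc t) x = gr t x" using assms by (simp_all add: ix_Suc gr_Suc)
  show "ix (Suc t) x < nx t (gr (Suc t) x)"
    "nx t (gr (Suc t) x) \<le> ix (Suc t) x + 31 * (Suc t - en t x)"
    using invariant x(1) unfolding e invariant_def fifo_def by blast+
  show "10 * Suc (Suc t) \<le> ix (Suc t) x" unfolding e using x(2) unfolding le_div_10 .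
qed

lemma rl_gt:
  assumes "x \<in> Q (Suc t)" shows "Suc t < rl (Suc t) x"
proof -
  have "10 * Suc (Suc t) \<le> ix (Suc t) x"
    using fresh_ix(1)[OF assms] old_ix(3)[of x] by (cases "fr t x") auto
  then show ?thesis unfolding Suc_le_eq[symmetric] le_div_10 .
qed

lemma gapless_Suc: "gapless (Suc t)"
  unfolding gapless_def
proof (intro allI conjI subsetI)
  fix i
  show "10 * Suc (Suc t) \<le> nx (Suc t) i" by (simp add: nx_Suc)
  fix m assume m: "m \<in> {10 * Suc (Suc t)..<nx (Suc t) i}"
  show "m \<in> ix (Suc t) ` {x \<in> Q (Suc t). gr (Suc t) x = i}"
  proof (cases "m < nx t i")
    case True
    then have "m \<in> {10 * Suc t..<nx t i}" using m by simp
    then have "m \<in> ix t ` {x \<in> Q t. gr t x = i}"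
      using invariant unfolding invariant_def gapless_def by blast
    then obtain x where x: "x \<in> Q t" "gr t x = i" "m = ix t x" by blast
    have "Suc t < rl t x" using m x(3) by auto
    \<comment> \<open>A number that has not expired belongs to a packet not yet released, which is
      therefore neither removed nor renumbered.\<close>
    then have "x \<in> Q (Suc t)" "\<not> fr t x" using removed_released[OF x(1)] x(1) by (auto simp: fresh_def)
    then show ?thesis using x by (intro image_eqI[where x = x]) (simp_all add: ix_Suc gr_Suc)
  next
    case False
    then have "base t i \<le> m" using m by simp
    then have "m - base t i \<in> {..<card (F t i)}"
      using m unfolding nx_Suc lessThan_iff atLeastLessThan_iff by linarith
    then obtain x where x: "x \<in> F t i" "m - base t i = card {y \<in> F t i. y < x}"
      unfolding card_less_image[OF finite_F, of t i, symmetric] by blast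
    then have f: "x \<in> Q (Suc t)" "fr t x" "gr (Suc t) x = i" by (auto simp: F_eq gr_Suc)
    then have "ix (Suc t) x = base t i + card {y \<in> F t i. y < x}" unfolding ix_Suc by simp
    then have "ix (Suc t) x = m" using x(2) \<open>base t i \<le> m\<close> by linarith
    then show ?thesis using f by blast
  qed
qed

text \<open>The second clause avoids a circularity: for newcomers it says only that
  \<open>dmax\<close> is positive, so the occupancy of a level can be bounded before anything is
  known about the release slots just assigned.\<close>

lemma entry_Suc:
  assumes "x \<in> Q (Suc t)"
  shows "en (Suc t) x \<le> Suc t" "Suc (Suc t) \<le> en (Suc t) x + dmax (gr (Suc t) x)"
    "\<And>\<tau>. en (Suc t) x \<le> \<tau> \<Longrightarrow> \<tau> \<le> Suc t \<Longrightarrow> x \<in> Q \<tau>"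
    "gr (Suc t) x = lev B (rank (Q (en (Suc t) x)) x)"
proof -
  have "en (Suc t) x \<le> Suc t \<and> Suc (Suc t) \<le> en (Suc t) x + dmax (gr (Suc t) x) \<and>
    (\<forall>\<tau>. en (Suc t) x \<le> \<tau> \<longrightarrow> \<tau> \<le> Suc t \<longrightarrow> x \<in> Q \<tau>) \<and>
    gr (Suc t) x = lev B (rank (Q (en (Suc t) x)) x)"
  proof (cases "fr t x")
    case True
    then show ?thesis
      using assms dmax_pos[of "gr (Suc t) x"] by (auto simp: en_Suc gr_Suc dest: le_antisym)
  next
    case False
    have "en (Suc t) x = en t x" "gr (Suc t) x = gr t x" using False by (simp_all add: en_Suc gr_Suc)
    then show ?thesis
      using trackedD[OF not_fresh(1)[OF False]] not_fresh(2)[OF False] assms by (auto simp: le_Suc_eq)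
  qed
  then show "en (Suc t) x \<le> Suc t" "Suc (Suc t) \<le> en (Suc t) x + dmax (gr (Suc t) x)"
    "\<And>\<tau>. en (Suc t) x \<le> \<tau> \<Longrightarrow> \<tau> \<le> Suc t \<Longrightarrow> x \<in> Q \<tau>"
    "gr (Suc t) x = lev B (rank (Q (en (Suc t) x)) x)"
    by auto
qed

text \<open>All these packets entered within the last \<open>dmax i\<close> slots, with a rank of
  level \<open>i\<close> on entry, so they occur in the history of the level over that window, which
  begins at \<open>s\<close>.\<close>

lemma card_group: "card {x \<in> Q (Suc t). gr (Suc t) x = i} \<le> 10 * dmax i"
proof -
  define s where "s = Suc (Suc t) - dmax i"
  have s: "s \<le> Suc t" "Suc t - s \<le> dmax i - 1" using dmax_pos[of i] by (auto simp: s_def)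
  have "{x \<in> Q (Suc t). gr (Suc t) x = i} \<subseteq> (\<Union>\<tau>\<in>{s..s + (Suc t - s)}. level_set \<tau> i)"
  proof
    fix x assume "x \<in> {x \<in> Q (Suc t). gr (Suc t) x = i}"
    then have x: "x \<in> Q (Suc t)" "gr (Suc t) x = i" by auto
    have "x \<in> level_set (en (Suc t) x) i"
      using entry_Suc[OF x(1)] x(2) by (auto simp: level_set_def)
    moreover have "s \<le> en (Suc t) x" "en (Suc t) x \<le> Suc t"
      using entry_Suc(1,2)[OF x(1)] x(2) by (auto simp: s_def)
    ultimately show "x \<in> (\<Union>\<tau>\<in>{s..s + (Suc t - s)}. level_set \<tau> i)" using s(1) by auto
  qed
  then have "card {x \<in> Q (Suc t). gr (Suc t) x = i} \<le> card (\<Union>\<tau>\<in>{s..s + (Suc t - s)}. level_set \<tau> i)"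
    by (intro card_mono) (auto simp: level_set_def)
  also have "\<dots> \<le> 2 * dmax (Suc i) + 2 * (Suc t - s)" by (rule card_level_history)
  also have "\<dots> \<le> 10 * dmax i" using s dmax_pos[of i] by simp
  finally show ?thesis .
qed

lemma nx_le: "nx (Suc t) i \<le> 10 * Suc (Suc t) + 10 * dmax i"
proof -
  have "nx (Suc t) i - 10 * Suc (Suc t) = card {10 * Suc (Suc t)..<nx (Suc t) i}" by simp
  also have "\<dots> \<le> card (ix (Suc t) ` {x \<in> Q (Suc t). gr (Suc t) x = i})"
    using gapless_Suc by (intro card_mono) (simp_all add: gapless_def)
  also have "\<dots> \<le> card {x \<in> Q (Suc t). gr (Suc t) x = i}" by (intro card_image_le) simp
  also have "\<dots> \<le> 10 * dmax i" by (rule card_group)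
  finally show ?thesis by linarith
qed

lemma rl_le:
  assumes "x \<in> Q (Suc t)" shows "rl (Suc t) x \<le> en (Suc t) x + dmax (gr (Suc t) x)"
proof (cases "fr t x")
  case True
  \<comment> \<open>The counter is an exclusive bound, so the last number assigned falls into a slot
    before \<open>Suc (Suc t) + dmax\<close>, that is, at most \<open>dmax\<close> after the entry
    in slot \<open>Suc t\<close>.\<close>
  have "\<not> 10 * (Suc (Suc t) + dmax (gr (Suc t) x)) \<le> ix (Suc t) x"
    using fresh_ix(2)[OF assms True] nx_le[of "gr (Suc t) x"] unfolding distrib_left by linarith
  then have "rl (Suc t) x < Suc (Suc t) + dmax (gr (Suc t) x)"
    unfolding le_div_10[symmetric] by simp
  then show ?thesis using True by (simp add: en_Suc)
next
  case False
  then show ?thesis using trackedD(2)[OF not_fresh(1)[OF False]] by (simp add: ix_Suc en_Suc gr_Suc)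
qed

lemma tracked_Suc: "tracked (Suc t)"
  unfolding tracked_def using entry_Suc rl_le by blast

lemma fifo_Suc: "fifo (Suc t)"
proof -
  have nx: "ix (Suc t) x < nx (Suc t) (gr (Suc t) x)"
      "nx (Suc t) (gr (Suc t) x) \<le> ix (Suc t) x + 31 * (Suc (Suc t) - en (Suc t) x)"
    if x: "x \<in> Q (Suc t)" for x
  proof -
    have "ix (Suc t) x < nx (Suc t) (gr (Suc t) x) \<and>
        nx (Suc t) (gr (Suc t) x) \<le> ix (Suc t) x + 31 * (Suc (Suc t) - en (Suc t) x)"
    proof (cases "fr t x")
      case True
      have "Suc (Suc t) - en (Suc t) x = 1" using True by (simp add: en_Suc)
      then show ?thesis
        using fresh_ix[OF x True] card_F[of "gr (Suc t) x"] unfolding nx_Suc by linarith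
    next
      case False
      \<comment> \<open>While a packet is still waiting, the counter lies above its unexpired number
        and thus above \<open>10 * Suc (Suc t)\<close>; the maximum in \<open>base\<close> causes no
        jump.\<close>
      have "nx (Suc t) (gr (Suc t) x) = nx t (gr (Suc t) x) + card (F t (gr (Suc t) x))"
        using old_ix(1,3)[OF False] by (simp add: nx_Suc)
      moreover have "Suc (Suc t) - en (Suc t) x = Suc (Suc t - en t x)"
        using False trackedD(1)[OF not_fresh(1)[OF False]] by (simp add: en_Suc)
      ultimately show ?thesis
        using old_ix(1,2)[OF False] card_F[of "gr (Suc t) x"] by simp
    qed
    then show "ix (Suc t) x < nx (Suc t) (gr (Suc t) x)"
      "nx (Suc t) (gr (Suc t) x) \<le> ix (Suc t) x + 31 * (Suc (Suc t) - en (Suc t) x)" by auto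
  qed
  have older: "ix (Suc t) x < ix (Suc t) y"
    if "y \<in> Q (Suc t)" "\<not> fr t x" "fr t y" "gr (Suc t) x = gr (Suc t) y" for x y
    using old_ix(1)[OF that(2)] fresh_ix(1)[OF that(1,3)] that(4) by simp
  have inj: "x = y"
    if xy: "x \<in> Q (Suc t)" "y \<in> Q (Suc t)" "gr (Suc t) x = gr (Suc t) y" "ix (Suc t) x = ix (Suc t) y"
    for x y
  proof (cases "fr t x \<longleftrightarrow> fr t y")
    case False
    then show ?thesis using older[of x y] older[of y x] xy by auto
  next
    case same: True
    show ?thesis
    proof (cases "fr t x")
      case True
      let ?F = "F t (gr (Suc t) y)"
      have "x \<in> ?F" "y \<in> ?F" using in_F[of x] in_F[of y] True same xy by auto
      moreover have "card {z \<in> ?F. z < x} = card {z \<in> ?F. z < y}"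
        using xy(3,4) True same by (simp add: ix_Suc)
      ultimately show ?thesis using inj_on_card_less[OF finite_F] by (simp add: inj_on_def)
    next
      case False
      then show ?thesis
        using ix_inj[of x y] not_fresh(1)[of x] not_fresh(1)[of y] same xy(3,4) by (simp add: ix_Suc gr_Suc)
    qed
  qed
  have order: "ix (Suc t) y < ix (Suc t) x + 31 * (Suc (en (Suc t) y) - en (Suc t) x)"
    if xy: "x \<in> Q (Suc t)" "y \<in> Q (Suc t)" "gr (Suc t) x = gr (Suc t) y" "ix (Suc t) x < ix (Suc t) y"
    for x y
  proof (cases "fr t y")
    case True
    then show ?thesis using nx[OF xy(1)] nx[OF xy(2)] xy(3) by (simp add: en_Suc)
  next
    case False
    then have "\<not> fr t x" using older[OF xy(1) False _ xy(3)[symmetric]] xy(4) by auto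
    moreover have "ix t y < ix t x + 31 * (Suc (en t y) - en t x)"
      using invariant xy(3,4) False \<open>\<not> fr t x\<close> not_fresh(1)[of x] not_fresh(1)[of y]
      by (simp add: invariant_def fifo_def ix_Suc gr_Suc)
    ultimately show ?thesis using False by (simp add: en_Suc ix_Suc)
  qed
  show ?thesis
    unfolding fifo_def using nx inj order by blast
qed

lemma on_time_Suc: "on_time (Suc t)"
  unfolding on_time_def
proof
  fix x assume x: "x \<in> Q (Suc t)"
  show "Suc t < du (Suc t) x \<and> du (Suc t) x \<le> rl (Suc t) x"
  proof (cases "sw t x")
    case True
    have "0 < rl (Suc t) x - Suc t" using rl_gt[OF x] by simp
    moreover have "du (Suc t) x = Suc t + delay (hop (gr (Suc t) x) (ix (Suc t) x) (rl (Suc t) x - Suc t))"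
      using True by (simp add: du_Suc li_Suc)
    ultimately show ?thesis
      using delay_hop_bounds[of "rl (Suc t) x - Suc t" "gr (Suc t) x" "ix (Suc t) x"] rl_gt[OF x]
      by linarith
  next
    case False
    then have "x \<in> Q t" "du t x \<noteq> Suc t" "\<not> fr t x" using fresh_sw[of x] by (auto simp: at_switch_def)
    then show ?thesis using dueD[of x] False by (simp add: du_Suc ix_Suc)
  qed
qed

lemma sw_aligned:
  assumes "x \<in> Q (Suc t)" "sw t x"
  shows "\<exists>J. 4 ^ J dvd rl (Suc t) x - Suc t \<and> Suc t < en (Suc t) x + 4 ^ J"
proof (cases "fr t x")
  case True
  then show ?thesis by (intro exI[of _ 0]) (simp add: en_Suc)
next
  case False
  then have x: "x \<in> Q t" "du t x = Suc t" using assms(2) by (auto simp: fresh_def at_switch_def)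
  then have "\<exists>J. 4 ^ J dvd rl t x - Suc t \<and> Suc t < en t x + 4 ^ J"
    using invariant unfolding invariant_def aligned_def by metis
  then show ?thesis using False by (simp add: ix_Suc en_Suc)
qed

text \<open>At the switch, the digit at position \<open>j\<close> is about to be spent and all lower ones are
  spent already.\<close>

lemma swE:
  assumes "x \<in> Q (Suc t)" "sw t x"
  obtains j d q where "li (Suc t) x = (gr (Suc t) x, j, d, ix (Suc t) x mod 10)" "d \<in> {1, 2, 3}"
    "rl (Suc t) x = Suc t + d * 4 ^ j + 4 ^ Suc j * q" "Suc t < en (Suc t) x + 4 ^ j"
proof -
  let ?r = "rl (Suc t) x - Suc t"
  have r: "0 < ?r" using rl_gt[OF assms(1)] by simp
  obtain j d q where h: "hop (gr (Suc t) x) (ix (Suc t) x) ?r = (gr (Suc t) x, j, d, ix (Suc t) x mod 10)"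
    "d \<in> {1, 2, 3}" "?r = d * 4 ^ j + 4 ^ Suc j * q" and max: "\<And>J. 4 ^ J dvd ?r \<Longrightarrow> J \<le> j"
    using hopE[OF r] by metis
  obtain J where J: "4 ^ J dvd ?r" "Suc t < en (Suc t) x + 4 ^ J" using sw_aligned[OF assms] by blast
  have "(4::nat) ^ J \<le> 4 ^ j" using max[OF J(1)] by (intro power_increasing) auto
  then have "Suc t < en (Suc t) x + 4 ^ j" using J(2) by linarith
  moreover have "rl (Suc t) x = Suc t + d * 4 ^ j + 4 ^ Suc j * q" using h(3) r by linarith
  moreover have "li (Suc t) x = (gr (Suc t) x, j, d, ix (Suc t) x mod 10)"
    using assms(2) h(1) by (simp add: li_Suc)
  ultimately show ?thesis using that h(2) by blast
qed

lemma aligned_Suc: "aligned (Suc t)"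
  unfolding aligned_def
proof
  fix x assume x: "x \<in> Q (Suc t)"
  show "\<exists>J. 4 ^ J dvd rl (Suc t) x - du (Suc t) x \<and> du (Suc t) x < en (Suc t) x + 4 ^ J"
  proof (cases "sw t x")
    case True
    obtain j d q where h: "li (Suc t) x = (gr (Suc t) x, j, d, ix (Suc t) x mod 10)" "d \<in> {1, 2, 3}"
      "rl (Suc t) x = Suc t + d * 4 ^ j + 4 ^ Suc j * q" "Suc t < en (Suc t) x + 4 ^ j"
      using swE[OF x True] by metis
    have du: "du (Suc t) x = Suc t + d * 4 ^ j" using True by (simp add: du_Suc h(1) delay_def)
    \<comment> \<open>Fewer than \<open>4 ^ j\<close> slots have passed and the current digit costs
      at most \<open>3 * 4 ^ j\<close> more, which restores the bound for exponent
      \<open>Suc j\<close>.\<close>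
    have "d * 4 ^ j \<le> 3 * 4 ^ j" using h(2) by (intro mult_right_mono) auto
    then have "du (Suc t) x < en (Suc t) x + 4 ^ Suc j" using h(4) du unfolding power_Suc by linarith
    moreover have "rl (Suc t) x - du (Suc t) x = 4 ^ Suc j * q" using h(3) du by linarith
    ultimately show ?thesis by (metis dvd_triv_left)
  next
    case False
    then have "x \<in> Q t" "\<not> fr t x" using fresh_sw[of x] by (auto simp: at_switch_def)
    moreover have "\<exists>J. 4 ^ J dvd rl t x - du t x \<and> du t x < en t x + 4 ^ J"
      using invariant \<open>x \<in> Q t\<close> unfolding invariant_def aligned_def by blast
    ultimately show ?thesis using False by (simp add: du_Suc ix_Suc en_Suc)
  qed
qed

text \<open>Two packets sharing a line would have release times that differ by a multiple of
  \<open>4 ^ (j + 1)\<close>, hence reservation numbers that differ by at least \<open>40 * 4 ^ j\<close>; but both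
  entered their level during the last \<open>4 ^ j\<close> slots, in which at most \<open>31 * 4 ^ j\<close> numbers
  are assigned.\<close>

lemma collision_free:
  assumes x: "x \<in> Q (Suc t)" "sw t x" and y: "y \<in> Q (Suc t)" "sw t y"
    and eq: "li (Suc t) x = li (Suc t) y"
  shows "x = y"
proof -
  have not_less: False
    if u: "u \<in> Q (Suc t)" "sw t u" and v: "v \<in> Q (Suc t)" "sw t v"
      and eq: "li (Suc t) u = li (Suc t) v" and less: "ix (Suc t) u < ix (Suc t) v" for u v
  proof -
    obtain j d q where hu: "li (Suc t) u = (gr (Suc t) u, j, d, ix (Suc t) u mod 10)"
      "rl (Suc t) u = Suc t + d * 4 ^ j + 4 ^ Suc j * q" "Suc t < en (Suc t) u + 4 ^ j"
      using swE[OF u] by metis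
    obtain j' d' q' where "li (Suc t) v = (gr (Suc t) v, j', d', ix (Suc t) v mod 10)"
      "rl (Suc t) v = Suc t + d' * 4 ^ j' + 4 ^ Suc j' * q'"
      using swE[OF v] by metis
    then have g: "gr (Suc t) u = gr (Suc t) v" and m: "ix (Suc t) u mod 10 = ix (Suc t) v mod 10"
      and hv: "rl (Suc t) v = Suc t + d * 4 ^ j + 4 ^ Suc j * q'"
      using eq hu(1) by auto
    \<comment> \<open>On a common channel the numbers agree modulo 10, so their difference is ten
      times that of the release slots.\<close>
    have iu: "ix (Suc t) u = 10 * rl (Suc t) u + ix (Suc t) v mod 10"
      unfolding m[symmetric] by simp
    have iv: "ix (Suc t) v = 10 * rl (Suc t) v + ix (Suc t) v mod 10" by simp
    have "rl (Suc t) u < rl (Suc t) v" using less iu iv by linarith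
    then have "4 ^ Suc j * q < 4 ^ Suc j * q'" unfolding hu(2) hv by linarith
    then have "q + 1 \<le> q'" by simp
    then have "4 ^ Suc j * (q + 1) \<le> 4 ^ Suc j * q'" by (rule mult_left_mono) simp
    then have "rl (Suc t) u + 4 * 4 ^ j \<le> rl (Suc t) v" unfolding hu(2) hv by simp
    then have far: "ix (Suc t) u + 40 * 4 ^ j \<le> ix (Suc t) v" using iu iv by linarith
    have "Suc (en (Suc t) v) - en (Suc t) u \<le> 4 ^ j" using hu(3) entry_Suc(1)[OF v(1)] by linarith
    then have "31 * (Suc (en (Suc t) v) - en (Suc t) u) \<le> 31 * 4 ^ j" by (rule mult_left_mono) simp
    moreover have "ix (Suc t) v < ix (Suc t) u + 31 * (Suc (en (Suc t) v) - en (Suc t) u)"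
      using fifo_Suc u(1) v(1) g less unfolding fifo_def by blast
    ultimately show False using far by linarith
  qed
  have "ix (Suc t) x = ix (Suc t) y"
    using not_less[OF x y eq] not_less[OF y x eq[symmetric]] by (cases rule: linorder_cases) auto
  moreover have "gr (Suc t) x = gr (Suc t) y"
    using eq x(2) y(2) by (simp add: li_Suc hop_def)
  ultimately show ?thesis using fifo_Suc x(1) y(1) unfolding fifo_def by blast
qed

lemma lines_ok_Suc: "lines_ok (Suc t)"
proof -
  have old: "li t x \<in> keys G" "du t x \<le> t + delay (li t x)" if "x \<in> Q t" for x
    using invariant that by (auto simp: invariant_def lines_ok_def)
  have old_inj: "x = y" if "x \<in> Q t" "y \<in> Q t" "li t x = li t y" "du t x = du t y" for x y
    using invariant that by (auto simp: invariant_def lines_ok_def)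
  have stay: "x \<in> Q t" "li (Suc t) x = li t x" "du (Suc t) x = du t x" if "\<not> sw t x" for x
    using that by (auto simp: at_switch_def li_Suc du_Suc)
  have keys: "li (Suc t) x \<in> keys G" if x: "x \<in> Q (Suc t)" for x
  proof (cases "sw t x")
    case True
    have "gr (Suc t) x \<le> G"
    proof (cases "fr t x")
      case True
      then show ?thesis using lev_rank_le[OF x] by (simp add: gr_Suc)
    next
      case False
      then show ?thesis using gr_le[OF not_fresh(1)[OF False]] by (simp add: gr_Suc)
    qed
    moreover have "0 < rl (Suc t) x - Suc t" "rl (Suc t) x - Suc t \<le> dmax (gr (Suc t) x)"
      using rl_gt[OF x] rl_le[OF x] entry_Suc(1)[OF x] by linarith+
    ultimately show ?thesis using True by (simp add: li_Suc hop_in_keys)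
  next
    case False
    then show ?thesis using old(1)[of x] stay[of x] by simp
  qed
  have due: "du (Suc t) x \<le> Suc t + delay (li (Suc t) x)" for x
    using old(2)[of x] stay[of x] by (cases "sw t x") (auto simp: du_Suc)
  have late: "\<not> (li (Suc t) x = li (Suc t) y \<and> du (Suc t) x = du (Suc t) y)"
    if "sw t x" "\<not> sw t y" for x y
    using old(2)[of y] stay[of y] that by (auto simp: du_Suc[of t x])
  have "x = y" if "x \<in> Q (Suc t)" "y \<in> Q (Suc t)" "li (Suc t) x = li (Suc t) y"
    "du (Suc t) x = du (Suc t) y" for x y
  proof (cases "sw t x \<longleftrightarrow> sw t y")
    case False
    then show ?thesis using late[of x y] late[of y x] that(3,4) by auto
  next
    case same: True
    show ?thesis
    proof (cases "sw t x")
      case True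
      then show ?thesis using collision_free[of x y] same that by auto
    next
      case False
      then show ?thesis using old_inj[of x y] stay[of x] stay[of y] same that(3,4) by auto
    qed
  qed
  then show ?thesis unfolding lines_ok_def using keys due by blast
qed

lemma invariant_Suc: "invariant (Suc t)"
  unfolding invariant_def
  using on_time_Suc tracked_Suc aligned_Suc lines_ok_Suc fifo_Suc gapless_Suc by blast

end

lemma invariant: "invariant t"
  by (induction t) (simp_all add: invariant_0 invariant_Suc)

end

section \<open>The switch\<close>

text \<open>The free inputs and the free outputs are equal in number, so any bijection between them
  completes the prescribed connections.\<close>

lemma extend_to_permutation:
  assumes fin: "finite T" and f: "inj_on f S" "f ` S \<subseteq> T" and g: "inj_on g S" "g ` S \<subseteq> T"
  shows "\<exists>\<sigma>. bij_betw \<sigma> T T \<and> (\<forall>x \<in> S. \<sigma> (f x) = g x)"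
proof -
  have "card (f ` S) = card (g ` S)" using f g by (simp add: card_image)
  then have "card (T - f ` S) = card (T - g ` S)"
    using fin f(2) g(2) by (simp add: card_Diff_subset finite_subset)
  then obtain h where h: "bij_betw h (T - f ` S) (T - g ` S)"
    using fin finite_same_card_bij[of "T - f ` S" "T - g ` S"] by auto
  define \<sigma> where "\<sigma> p = (if p \<in> f ` S then g (the_inv_into S f p) else h p)" for p
  have on_S: "\<sigma> (f x) = g x" if "x \<in> S" for x
    using that f(1) by (simp add: \<sigma>_def the_inv_into_f_f)
  have "bij_betw \<sigma> (f ` S) (g ` S)"
  proof (rule bij_betw_imageI)
    show "inj_on \<sigma> (f ` S)"
      using on_S g(1) by (auto simp: inj_on_def)
    show "\<sigma> ` f ` S = g ` S" using on_S by (auto simp: image_image)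
  qed
  moreover have "bij_betw \<sigma> (T - f ` S) (T - g ` S)"
    using h by (rule bij_betw_cong[THEN iffD1, rotated]) (simp add: \<sigma>_def)
  ultimately have "bij_betw \<sigma> (f ` S \<union> (T - f ` S)) (g ` S \<union> (T - g ` S))"
    by (rule bij_betw_combine) auto
  moreover have "f ` S \<union> (T - f ` S) = T" "g ` S \<union> (T - g ` S) = T" using f(2) g(2) by auto
  ultimately show ?thesis using on_S by auto
qed

section \<open>Network and controller\<close>

definition feedback_net :: "nat \<Rightarrow> nat \<Rightarrow> (nat \<Rightarrow> nat) \<Rightarrow> onet" where
  "feedback_net n M dl = \<lparr>nports = n, arr_in = M, dep_out = M, loss_out = Suc M,
     fdls = map (\<lambda>k. (k, k, dl k)) [0..<M]\<rparr>"

lemma feedback_net_simps [simp]: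
  "nports (feedback_net n M dl) = n" "arr_in (feedback_net n M dl) = M"
  "dep_out (feedback_net n M dl) = M" "loss_out (feedback_net n M dl) = Suc M"
  "length (fdls (feedback_net n M dl)) = M"
  "k < M \<Longrightarrow> fdl_out (feedback_net n M dl) k = k"
  "k < M \<Longrightarrow> fdl_in (feedback_net n M dl) k = k"
  "k < M \<Longrightarrow> fdl_delay (feedback_net n M dl) k = dl k"
  by (simp_all add: feedback_net_def fdl_out_def fdl_in_def fdl_delay_def)

lemma wf_feedback_net:
  assumes "Suc M < n" shows "wf_net (feedback_net n M dl)"
proof -
  have m: "map fst (fdls (feedback_net n M dl)) = [0..<M]"
    "map (\<lambda>x. fst (snd x)) (fdls (feedback_net n M dl)) = [0..<M]"
    by (simp_all add: feedback_net_def comp_def)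
  show ?thesis unfolding wf_net_def m using assms by simp
qed

lemma route_feedback_net:
  "\<sigma> p = M \<Longrightarrow> route (Suc f) (feedback_net n M dl) \<sigma> p = Dep"
  "\<sigma> p = Suc M \<Longrightarrow> route (Suc f) (feedback_net n M dl) \<sigma> p = Loss"
  "\<sigma> p < M \<Longrightarrow> 0 < dl (\<sigma> p) \<Longrightarrow> route (Suc f) (feedback_net n M dl) \<sigma> p = Line (\<sigma> p)"
proof -
  assume a: "\<sigma> p < M" "0 < dl (\<sigma> p)"
  have "(THE k. k < M \<and> fdl_out (feedback_net n M dl) k = \<sigma> p) = \<sigma> p"
    using a by (intro the_equality) auto
  moreover have "\<exists>k<M. fdl_out (feedback_net n M dl) k = \<sigma> p" using a by auto
  ultimately show "route (Suc f) (feedback_net n M dl) \<sigma> p = Line (\<sigma> p)"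
    using a by (simp add: Let_def)
qed simp_all

definition in_port :: "nat \<Rightarrow> (key \<Rightarrow> nat) \<Rightarrow> qstate \<Rightarrow> real \<Rightarrow> nat" where
  "in_port M enc g x = (if x \<in> stored g then enc (line g x) else M)"

definition out_port :: "nat \<Rightarrow> (key \<Rightarrow> nat) \<Rightarrow> nat \<Rightarrow> nat \<Rightarrow> real option \<Rightarrow> bool \<Rightarrow> qstate \<Rightarrow> real \<Rightarrow> nat" where
  "out_port M enc B t ar cc g x =
     (if x \<in> served (stored g) ar cc then M
      else if x \<in> dropped B (stored g) ar cc then Suc M
      else enc (line (step B t ar cc g) x))"

definition wiring ::
    "nat \<Rightarrow> nat \<Rightarrow> (key \<Rightarrow> nat) \<Rightarrow> nat \<Rightarrow> nat \<Rightarrow> real option \<Rightarrow> bool \<Rightarrow> qstate \<Rightarrow> (nat \<Rightarrow> nat) \<Rightarrow> bool" where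
  "wiring n M enc B t ar cc g \<sigma> \<longleftrightarrow> bij_betw \<sigma> {..<n} {..<n} \<and>
     (\<forall>x \<in> offered (stored g) ar. at_switch g t x \<longrightarrow>
        \<sigma> (in_port M enc g x) = out_port M enc B t ar cc g x)"

text \<open>Validity is demanded on every input, including arrival sequences with repeated
  priorities, for which a suitable wiring need not exist; the default \<open>id\<close> is still a
  permutation.\<close>

definition controller :: "nat \<Rightarrow> nat \<Rightarrow> (key \<Rightarrow> nat) \<Rightarrow> nat \<Rightarrow> policy" where
  "controller n M enc B a c t =
     (let w = wiring n M enc B t (a t) (c t) (run B a c (t - 1))
      in if \<exists>\<sigma>. w \<sigma> then SOME \<sigma>. w \<sigma> else id)"

lemma valid_controller:
  "valid_policy (feedback_net n M dl) (controller n M enc B)"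
  unfolding valid_policy_def
proof (intro conjI allI impI)
  fix a :: "nat \<Rightarrow> real option" and c :: "nat \<Rightarrow> bool" and t
  show "bij_betw (controller n M enc B a c t)
      {..<nports (feedback_net n M dl)} {..<nports (feedback_net n M dl)}"
  proof (cases "\<exists>\<sigma>. wiring n M enc B t (a t) (c t) (run B a c (t - 1)) \<sigma>")
    case True
    from someI_ex[OF this] have "bij_betw (SOME \<sigma>. wiring n M enc B t (a t) (c t) (run B a c (t - 1)) \<sigma>)
        {..<n} {..<n}"
      by (simp only: wiring_def)
    then show ?thesis using True by (simp add: controller_def Let_def)
  next
    case False
    then have "controller n M enc B a c t = id" unfolding controller_def Let_def by (rule if_not_P)
    then show ?thesis by simp
  qed
next
  fix a a' :: "nat \<Rightarrow> real option" and c c' :: "nat \<Rightarrow> bool" and t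
  assume "\<forall>s\<le>t. a s = a' s \<and> c s = c' s"
  then have "run B a c (t - 1) = run B a' c' (t - 1)" "a t = a' t" "c t = c' t"
    by (auto intro: run_cong)
  then show "controller n M enc B a c t = controller n M enc B a' c' t"
    by (simp add: controller_def)
qed

section \<open>The network carries out the schedule\<close>

locale pq_net = pq_run +
  fixes n M :: nat and enc :: "key \<Rightarrow> nat" and dl :: "nat \<Rightarrow> nat"
  assumes ports: "Suc M < n"
    and enc_inj: "inj_on enc (keys G)" and enc_less: "enc ` keys G \<subseteq> {..<M}"
    and dl_enc: "k \<in> keys G \<Longrightarrow> dl (enc k) = delay k"
begin

abbreviation "net \<equiv> feedback_net n M dl"
abbreviation "pol \<equiv> controller n M enc B"

definition here :: "nat \<Rightarrow> real set" where
  "here t = {x \<in> offered (Q t) (a (Suc t)). sw t x}"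

abbreviation "inp t \<equiv> in_port M enc (run B a c t)"
abbreviation "outp t \<equiv> out_port M enc B (Suc t) (a (Suc t)) (c (Suc t)) (run B a c t)"
abbreviation "dep t \<equiv> served (Q t) (a (Suc t)) (c (Suc t))"
abbreviation "los t \<equiv> dropped B (Q t) (a (Suc t)) (c (Suc t))"

lemma li_keys: "x \<in> Q t \<Longrightarrow> li t x \<in> keys G"
  and line_inj: "x \<in> Q t \<Longrightarrow> y \<in> Q t \<Longrightarrow> li t x = li t y \<Longrightarrow> du t x = du t y \<Longrightarrow> x = y"
  using invariant[of t] by (auto simp: invariant_def lines_ok_def)

lemma enc_li_less: "x \<in> Q t \<Longrightarrow> enc (li t x) < M"
  using li_keys[of x t] enc_less by auto

lemma delay_pos: "k \<in> keys G \<Longrightarrow> 0 < delay k"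
  by (auto simp: keys_def delay_def)

lemma enc_li_eq: "x \<in> Q t \<Longrightarrow> y \<in> Q t \<Longrightarrow> enc (li t x) = enc (li t y) \<Longrightarrow> li t x = li t y"
  using inj_onD[OF enc_inj] li_keys by blast

text \<open>Departures and losses can be realised because packets of extreme rank are released in
  time to be at a switch input.\<close>

lemma removed_here: "dep t \<subseteq> here t" "los t \<subseteq> here t"
proof -
  have "x \<in> here t" if "x \<in> dep t \<union> los t" for x
  proof -
    have "x \<in> offered (Q t) (a (Suc t))"
      using that served_subset[of "Q t" "a (Suc t)" "c (Suc t)"]
        dropped_subset[of "Q t" B "a (Suc t)" "c (Suc t)"] by auto
    moreover have "x \<notin> Q (Suc t)" using that by (auto simp: Q_Suc kept_def)
    ultimately show ?thesis using removed_sw[OF invariant] by (simp add: here_def)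
  qed
  then show "dep t \<subseteq> here t" "los t \<subseteq> here t" by auto
qed

lemma Q_Suc_iff: "x \<in> Q (Suc t) \<longleftrightarrow> x \<in> offered (Q t) (a (Suc t)) \<and> x \<notin> dep t \<and> x \<notin> los t"
  by (auto simp: Q_Suc kept_def)

lemma outp_eq:
  "outp t x = (if x \<in> dep t then M else if x \<in> los t then Suc M else enc (li (Suc t) x))"
  by (simp add: out_port_def run.simps(2))

text \<open>Stored packets at the switch all have exit slot \<open>Suc t\<close>, so a common port
  would mean a common line and a common exit slot. The arrival has port \<open>M\<close> to
  itself.\<close>

lemma inj_inp: "inj_on (inp t) (here t)"
proof (rule inj_onI)
  fix x y assume xy: "x \<in> here t" "y \<in> here t" "inp t x = inp t y"
  show "x = y"
  proof (cases "x \<in> Q t \<longleftrightarrow> y \<in> Q t")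
    case False
    then show ?thesis using xy(3) enc_li_less[of x t] enc_li_less[of y t] by (auto simp: in_port_def)
  next
    case same: True
    show ?thesis
    proof (cases "x \<in> Q t")
      case True
      then have "li t x = li t y" using enc_li_eq xy(3) same by (simp add: in_port_def)
      moreover have "du t x = du t y" using xy(1,2) True same by (simp add: here_def at_switch_def)
      ultimately show ?thesis using line_inj True same by blast
    next
      case False
      then show ?thesis using xy(1,2) same by (auto simp: here_def offered_def)
    qed
  qed
qed

lemma inj_outp: "inj_on (outp t) (here t)"
proof (rule inj_onI)
  fix x y assume xy: "x \<in> here t" "y \<in> here t" "outp t x = outp t y"
  have kept: "u \<in> Q (Suc t)" if "u \<in> here t" "u \<notin> dep t" "u \<notin> los t" for u
    using that by (simp add: Q_Suc_iff here_def)
  have less: "outp t u < M" if "u \<in> here t" "u \<notin> dep t" "u \<notin> los t" for u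
    using enc_li_less[OF kept[OF that]] that by (simp add: outp_eq)
  have dep1: "u = v" if "u \<in> dep t" "v \<in> dep t" for u v
    using that by (auto simp: served_def split: if_splits)
  have los1: "u = v" if "u \<in> los t" "v \<in> los t" for u v
    using that by (auto simp: dropped_def split: if_splits)
  have outM: "outp t u = M \<longleftrightarrow> u \<in> dep t" "outp t u = Suc M \<longleftrightarrow> u \<in> los t" if "u \<in> here t" for u
    using less[OF that] served_dropped_disjoint[of "Q t" "a (Suc t)" "c (Suc t)" B]
    by (auto simp: outp_eq split: if_splits)
  show "x = y"
  proof (cases "x \<in> dep t \<or> x \<in> los t")
    case True
    then show ?thesis using outM[OF xy(1)] outM[OF xy(2)] xy(3) dep1[of x y] los1[of x y] by auto
  next
    case False
    then have nx: "x \<notin> dep t" "x \<notin> los t" and ny: "y \<notin> dep t" "y \<notin> los t"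
      using outM[OF xy(1)] outM[OF xy(2)] xy(3) by auto
    have k: "x \<in> Q (Suc t)" "y \<in> Q (Suc t)" using kept xy nx ny by auto
    have "li (Suc t) x = li (Suc t) y" using enc_li_eq[OF k] xy(3) nx ny by (simp add: outp_eq)
    then show ?thesis using collision_free[OF invariant k(1) _ k(2)] xy(1,2) by (simp add: here_def)
  qed
qed

lemma pol_wired: "x \<in> here t \<Longrightarrow> pol a c (Suc t) (inp t x) = outp t x"
proof -
  assume x: "x \<in> here t"
  let ?w = "wiring n M enc B (Suc t) (a (Suc t)) (c (Suc t)) (run B a c t)"
  have "inp t u < n" for u
    using enc_li_less[of u t] ports by (cases "u \<in> Q t") (simp_all add: in_port_def)
  then have "inp t ` here t \<subseteq> {..<n}" by auto
  moreover have "outp t ` here t \<subseteq> {..<n}"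
  proof
    fix p assume "p \<in> outp t ` here t"
    then obtain u where u: "u \<in> here t" "p = outp t u" by blast
    show "p \<in> {..<n}"
    proof (cases "u \<in> dep t \<or> u \<in> los t")
      case True
      then show ?thesis using u ports by (auto simp: outp_eq)
    next
      case False
      then have "u \<in> Q (Suc t)" using u(1) by (simp add: Q_Suc_iff here_def)
      then show ?thesis using u(2) False enc_li_less[of u "Suc t"] ports by (simp add: outp_eq)
    qed
  qed
  ultimately obtain \<sigma> where "bij_betw \<sigma> {..<n} {..<n}" "\<forall>x \<in> here t. \<sigma> (inp t x) = outp t x"
    using extend_to_permutation[OF finite_lessThan inj_inp _ inj_outp] by blast
  then have "?w \<sigma>" unfolding wiring_def here_def by simp
  then have ex: "\<exists>\<sigma>. ?w \<sigma>" by blast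
  then have "?w (pol a c (Suc t))"
    using someI_ex[OF ex] by (simp add: controller_def)
  then show ?thesis using x unfolding wiring_def here_def by blast
qed

text \<open>The contents of the lines as the schedule predicts them; \<open>sim_located\<close>
  identifies them with the simulated state.\<close>

definition located :: "nat \<Rightarrow> pstate" where
  "located t = (\<lambda>x. (x, enc (li t x), du t x)) ` Q t"

definition dst :: "nat \<Rightarrow> real \<Rightarrow> dest" where
  "dst t x = (if x \<in> dep t then Dep else if x \<in> los t then Loss else Line (enc (li (Suc t) x)))"

lemma routed_located:
  "routed_at net (pol a c (Suc t)) (a (Suc t)) (located t) (Suc t) = (\<lambda>x. (x, dst t x)) ` here t"
proof -
  have inputs: "inputs_at net (a (Suc t)) (located t) (Suc t) = (\<lambda>x. (x, inp t x)) ` here t"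
  proof (intro set_eqI iffI)
    fix z assume "z \<in> inputs_at net (a (Suc t)) (located t) (Suc t)"
    then consider x where "z = (x, M)" "a (Suc t) = Some x"
      | x k where "z = (x, fdl_in net k)" "(x, k, Suc t) \<in> located t"
      unfolding inputs_at_def by auto
    then show "z \<in> (\<lambda>x. (x, inp t x)) ` here t"
    proof cases
      case 1
      then have "x \<notin> Q t" using arrival_new[of t] by auto
      then show ?thesis using 1 by (auto simp: here_def offered_def at_switch_def in_port_def)
    next
      case 2
      then have x: "x \<in> Q t" "k = enc (li t x)" "du t x = Suc t" by (auto simp: located_def)
      then have "z = (x, inp t x)" using 2(1) enc_li_less[of x t] by (simp add: in_port_def)
      then show ?thesis using x by (auto simp: here_def offered_def at_switch_def)
    qed
  next
    fix z assume "z \<in> (\<lambda>x. (x, inp t x)) ` here t"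
    then obtain x where x: "x \<in> here t" "z = (x, inp t x)" by blast
    show "z \<in> inputs_at net (a (Suc t)) (located t) (Suc t)"
    proof (cases "x \<in> Q t")
      case True
      then have "(x, enc (li t x), Suc t) \<in> located t"
        using x(1) by (auto simp: located_def here_def at_switch_def)
      moreover have "z = (x, fdl_in net (enc (li t x)))"
        using x(2) True enc_li_less[of x t] by (simp add: in_port_def)
      ultimately show ?thesis unfolding inputs_at_def by blast
    next
      case False
      then show ?thesis using x by (auto simp: inputs_at_def here_def offered_def in_port_def)
    qed
  qed
  have "route (Suc (nports net)) net (pol a c (Suc t)) (inp t x) = dst t x" if x: "x \<in> here t" for x
  proof (cases "x \<in> dep t \<or> x \<in> los t")
    case True
    then show ?thesis
      using pol_wired[OF x] unfolding dst_def outp_eq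
      by (auto intro: route_feedback_net split: if_splits)
  next
    case False
    then have k: "x \<in> Q (Suc t)" using x by (simp add: Q_Suc_iff here_def)
    have p: "pol a c (Suc t) (inp t x) = enc (li (Suc t) x)"
      using pol_wired[OF x] False by (simp add: outp_eq)
    have "route (Suc (nports net)) net (pol a c (Suc t)) (inp t x) = Line (pol a c (Suc t) (inp t x))"
      by (rule route_feedback_net(3))
        (use p enc_li_less[OF k] dl_enc[OF li_keys[OF k]] delay_pos[OF li_keys[OF k]] in simp_all)
    then show ?thesis using False p by (simp add: dst_def)
  qed
  then show ?thesis
    unfolding routed_at_def inputs image_image by (intro image_cong) (simp_all del: route.simps)
qed

lemma next_located:
  "next_state net (pol a c (Suc t)) (a (Suc t)) (located t) (Suc t) = located (Suc t)"
proof (intro set_eqI iffI)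
  fix z assume "z \<in> next_state net (pol a c (Suc t)) (a (Suc t)) (located t) (Suc t)"
  then consider x k e where "z = (x, k, e)" "(x, k, e) \<in> located t" "Suc t < e"
    | x k where "z = (x, k, Suc t + fdl_delay net k)" "(x, Line k) \<in> (\<lambda>x. (x, dst t x)) ` here t"
    unfolding next_state_def routed_located by auto
  then show "z \<in> located (Suc t)"
  proof cases
    case 1
    then have x: "x \<in> Q t" "k = enc (li t x)" "e = du t x" by (auto simp: located_def)
    then have "\<not> sw t x" using 1(3) by (simp add: at_switch_def)
    moreover have "x \<in> Q (Suc t)"
      using x(1) \<open>\<not> sw t x\<close> removed_here[of t] by (auto simp: Q_Suc_iff here_def offered_def)
    ultimately show ?thesis
      using 1(1) x by (auto simp: located_def li_Suc du_Suc)
  next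
    case 2
    then have x: "x \<in> here t" "x \<notin> dep t" "x \<notin> los t" "k = enc (li (Suc t) x)"
      by (auto simp: dst_def split: if_splits)
    then have k: "x \<in> Q (Suc t)" by (simp add: Q_Suc_iff here_def)
    have "fdl_delay net k = delay (li (Suc t) x)"
      using x(4) enc_li_less[OF k] dl_enc[OF li_keys[OF k]] by simp
    moreover have "du (Suc t) x = Suc t + delay (li (Suc t) x)"
      using x(1) by (simp add: du_Suc here_def)
    ultimately have "z = (x, enc (li (Suc t) x), du (Suc t) x)" using 2(1) x(4) by simp
    then show ?thesis using k unfolding located_def by blast
  qed
next
  fix z assume "z \<in> located (Suc t)"
  then obtain x where x: "x \<in> Q (Suc t)" "z = (x, enc (li (Suc t) x), du (Suc t) x)"
    by (auto simp: located_def)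
  show "z \<in> next_state net (pol a c (Suc t)) (a (Suc t)) (located t) (Suc t)"
  proof (cases "sw t x")
    case True
    then have "x \<in> here t" "dst t x = Line (enc (li (Suc t) x))"
      using x(1) by (auto simp: here_def dst_def Q_Suc_iff)
    then have "(x, Line (enc (li (Suc t) x))) \<in> (\<lambda>x. (x, dst t x)) ` here t" by (metis imageI)
    moreover have "z = (x, enc (li (Suc t) x), Suc t + fdl_delay net (enc (li (Suc t) x)))"
      using x(2) True enc_li_less[OF x(1)] dl_enc[OF li_keys[OF x(1)]] by (simp add: du_Suc)
    ultimately show ?thesis unfolding next_state_def routed_located by blast
  next
    case False
    then have "x \<in> Q t" "du t x \<noteq> Suc t" by (auto simp: at_switch_def)
    moreover have "t < du t x" using dueD[OF invariant \<open>x \<in> Q t\<close>] by simp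
    ultimately have "z \<in> located t" "Suc t < du t x" "z = (x, enc (li t x), du t x)"
      using x(2) False by (auto simp: located_def li_Suc du_Suc)
    then show ?thesis unfolding next_state_def by blast
  qed
qed

lemma sim_located: "sim net pol a c t = located t"
proof (induction t)
  case (Suc t)
  then show ?case using next_located[of t] by simp
qed (simp add: located_def)

lemma qlen_eq: "qlen net pol a c t = card (Q t)"
  unfolding qlen_def sim_located located_def by (intro card_image) (simp add: inj_on_def)

lemma present_eq: "present net pol a c (Suc t) = offered (Q t) (a (Suc t))"
  unfolding present_def sim_located located_def offered_def by auto

lemma departed_eq: "departed net pol a c (Suc t) = dep t"
  and lost_eq: "lost net pol a c (Suc t) = los t"
proof -
  have r: "routed net pol a c (Suc t) = (\<lambda>x. (x, dst t x)) ` here t"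
    unfolding routed_def diff_Suc_1 sim_located by (rule routed_located)
  have mem: "(x, e) \<in> routed net pol a c (Suc t) \<longleftrightarrow> x \<in> here t \<and> dst t x = e" for x e
    unfolding r by auto
  have "x \<in> here t \<and> dst t x = Dep \<longleftrightarrow> x \<in> dep t" "x \<in> here t \<and> dst t x = Loss \<longleftrightarrow> x \<in> los t" for x
    using removed_here[of t] served_dropped_disjoint[of "Q t" "a (Suc t)" "c (Suc t)" B]
    unfolding dst_def by (auto split: if_splits)
  then show "departed net pol a c (Suc t) = dep t" "lost net pol a c (Suc t) = los t"
    unfolding departed_def lost_def mem by simp_all
qed

lemma card_offered: "card (offered (Q t) (a (Suc t))) = card (Q t) + ind (a (Suc t) \<noteq> None)"
  using arrival_new[of t] by (cases "a (Suc t)") (auto simp: offered_def ind_def)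

lemma priority_queue_slot:
  "int (qlen net pol a c (Suc t)) = int (qlen net pol a c t) + int (ind (a (Suc t) \<noteq> None))
     - int (card (departed net pol a c (Suc t))) - int (card (lost net pol a c (Suc t)))"
  "card (departed net pol a c (Suc t)) =
     ind (c (Suc t) \<and> qlen net pol a c t + ind (a (Suc t) \<noteq> None) > 0)"
  "card (lost net pol a c (Suc t)) =
     ind (\<not> c (Suc t) \<and> qlen net pol a c t = B \<and> ind (a (Suc t) \<noteq> None) = 1)"
  "x \<in> departed net pol a c (Suc t) \<Longrightarrow> tag net pol a c (Suc t) x = 1"
  "x \<in> lost net pol a c (Suc t) \<Longrightarrow> tag net pol a c (Suc t) x = B + 1"
proof -
  let ?P = "offered (Q t) (a (Suc t))"
  note eqs = departed_eq lost_eq qlen_eq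
  show "int (qlen net pol a c (Suc t)) = int (qlen net pol a c t) + int (ind (a (Suc t) \<noteq> None))
     - int (card (departed net pol a c (Suc t))) - int (card (lost net pol a c (Suc t)))"
    using card_kept[OF finite_Q, of B t "a (Suc t)" "c (Suc t)"] card_offered[of t]
    unfolding eqs Q_Suc by linarith
  have "?P \<noteq> {} \<longleftrightarrow> card ?P > 0" by (simp add: card_gt_0_iff)
  then show "card (departed net pol a c (Suc t)) =
     ind (c (Suc t) \<and> qlen net pol a c t + ind (a (Suc t) \<noteq> None) > 0)"
    unfolding eqs card_offered[symmetric] by (simp add: served_def ind_def)
  have "card ?P = Suc B \<longleftrightarrow> card (Q t) = B \<and> ind (a (Suc t) \<noteq> None) = 1"
    using card_offered[of t] card_Q_le[of t] by (auto simp: ind_def)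
  then show "card (lost net pol a c (Suc t)) =
     ind (\<not> c (Suc t) \<and> qlen net pol a c t = B \<and> ind (a (Suc t) \<noteq> None) = 1)"
    unfolding eqs by (simp add: dropped_def ind_def)
  show "tag net pol a c (Suc t) x = 1" if "x \<in> departed net pol a c (Suc t)"
  proof -
    have x: "x = Max ?P" "?P \<noteq> {}" using that by (simp_all add: eqs served_def split: if_splits)
    then have "x \<in> ?P" "\<And>y. y \<in> ?P \<Longrightarrow> y \<le> x" by simp_all
    then have "{y \<in> ?P. x \<le> y} = {x}" by (auto intro: antisym)
    then show ?thesis by (simp add: tag_def present_eq)
  qed
  show "tag net pol a c (Suc t) x = B + 1" if "x \<in> lost net pol a c (Suc t)"
  proof -
    have "x = Min ?P" "card ?P = Suc B" using that by (simp_all add: eqs dropped_def split: if_splits)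
    then have "{y \<in> ?P. x \<le> y} = ?P" by auto
    then show ?thesis using \<open>card ?P = Suc B\<close> by (simp add: tag_def present_eq)
  qed
qed

end

lemma is_priority_queue_feedback_net:
  assumes "B \<le> 2 * (thr (Suc G) - 1)" "Suc M < n"
    and "inj_on enc (keys G)" "enc ` keys G \<subseteq> {..<M}" "\<And>k. k \<in> keys G \<Longrightarrow> dl (enc k) = delay k"
  shows "is_priority_queue (feedback_net n M dl) (controller n M enc B) B"
  unfolding is_priority_queue_def
proof (intro allI impI)
  fix a :: "nat \<Rightarrow> real option" and c :: "nat \<Rightarrow> bool" and t :: nat
  assume unique: "\<forall>s t x. 0 < s \<longrightarrow> 0 < t \<longrightarrow> a s = Some x \<longrightarrow> a t = Some x \<longrightarrow> s = t" and "0 < t"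
  interpret pq_net B G a c n M enc dl
    using assms unique by unfold_locales blast+
  obtain s where s: "t = Suc s" using \<open>0 < t\<close> gr0_implies_Suc by blast
  show "let q = qlen net pol a c; ar = ind (a t \<noteq> None);
            dd = card (departed net pol a c t); ll = card (lost net pol a c t) in
        int (q t) = int (q (t - 1)) + int ar - int dd - int ll \<and>
        dd = ind (c t \<and> q (t - 1) + ar > 0) \<and>
        ll = ind (\<not> c t \<and> q (t - 1) = B \<and> ar = 1) \<and>
        (\<forall>x \<in> departed net pol a c t. tag net pol a c t x = 1) \<and>
        (\<forall>x \<in> lost net pol a c t. tag net pol a c t x = B + 1)"
    unfolding Let_def s diff_Suc_1 using priority_queue_slot by blast
qed

section \<open>Dimensions\<close>

text \<open>On each of its ten channels, level \<open>i\<close> has three lines for each of the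
  \<open>i\<close> lower positions and one for the top position.\<close>

lemma finite_keys: "finite (keys G)" and card_keys: "card (keys G) \<le> 15 * G * Suc G + 10 * Suc G"
proof -
  define K :: "nat \<Rightarrow> key set" where
    "K i = (\<lambda>((j, d), c). (i, j, d, c)) ` (({..<i} \<times> {1, 2, 3} \<union> {(i, 1)}) \<times> {..<10})" for i
  have fin: "finite (K i)" for i by (simp add: K_def)
  have sub: "keys G \<subseteq> (\<Union>i\<in>{..G}. K i)"
  proof
    fix k assume k: "k \<in> keys G"
    obtain i j d c where e: "k = (i, j, d, c)" by (cases k)
    have "((j, d), c) \<in> ({..<i} \<times> {1, 2, 3} \<union> {(i, 1)}) \<times> {..<10}" "i \<le> G"
      using k by (auto simp: e keys_def)
    then have "k \<in> K i" unfolding K_def e by (intro image_eqI[of _ _ "((j, d), c)"]) simp_all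
    then show "k \<in> (\<Union>i\<in>{..G}. K i)" using \<open>i \<le> G\<close> by blast
  qed
  then show "finite (keys G)" by (rule finite_subset) (simp add: fin)
  have K: "card (K i) \<le> 10 * (3 * i + 1)" for i
  proof -
    have "card (K i) \<le> card (({..<i} \<times> {1, 2, 3 :: nat} \<union> {(i, 1)}) \<times> {..<10 :: nat})"
      unfolding K_def by (intro card_image_le) simp
    also have "\<dots> \<le> 10 * (3 * i + 1)"
      using card_Un_le[of "{..<i} \<times> {1, 2, 3 :: nat}" "{(i, 1)}"]
      by (simp add: card_cartesian_product)
    finally show ?thesis .
  qed
  have "card (keys G) \<le> card (\<Union>i\<in>{..G}. K i)" using sub fin by (intro card_mono) simp_all
  also have "\<dots> \<le> (\<Sum>i\<in>{..G}. card (K i))" by (intro card_UN_le) simp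
  also have "\<dots> \<le> (\<Sum>i\<in>{..G}. 10 * (3 * i + 1))" by (intro sum_mono K)
  also have "\<dots> = 15 * G * Suc G + 10 * Suc G" by (induction G) (auto simp: algebra_simps)
  finally show "card (keys G) \<le> 15 * G * Suc G + 10 * Suc G" .
qed

text \<open>The induction starts with the equality \<open>12 = 12\<close>. In each step the left
  side grows by \<open>9 * 4 ^ Suc G\<close>, and twice \<open>dmax (Suc (Suc G))\<close> is nearly
  \<open>32 / 3 * 4 ^ Suc G\<close>.\<close>

lemma thr_capacity: "3 * 4 ^ Suc G \<le> 2 * (thr (Suc G) - 1) + 2"
proof -
  have dm: "3 * dmax (Suc (Suc i)) + 1 = 16 * 4 ^ Suc i" for i
    using dmax_closed_form[of "Suc (Suc i)"] by (simp del: dmax.simps)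
  have "3 * 4 ^ Suc G \<le> 2 * thr (Suc G)"
  proof (induction G)
    case (Suc G)
    have "thr (Suc (Suc G)) = thr (Suc G) + dmax (Suc (Suc G))" by simp
    moreover have "(1::nat) \<le> 4 ^ Suc G" by simp
    ultimately show ?case using Suc dm[of G] by simp
  qed simp
  then show ?thesis using less_thr[of "Suc G"] by linarith
qed

theorem theorem2:
  fixes l :: nat
  assumes "2 \<le> l"
  shows "\<exists>net R. wf_net net \<and>
           nports net = (9 * l\<^sup>2 + 39 * l) div 2 + 8 \<and>
           length (fdls net) = 9 * (l\<^sup>2 - l) div 2 + 18 \<and>
           valid_policy net R \<and>
           is_priority_queue net R (3 * 2 ^ (l - 1) - 2)"
proof -
  define B where "B = 3 * 2 ^ (l - 1) - (2::nat)"
  define n where "n = (9 * l\<^sup>2 + 39 * l) div 2 + 8"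
  define M where "M = 9 * (l\<^sup>2 - l) div 2 + 18"
  \<comment> \<open>Raising \<open>l\<close> by two multiplies the buffer by about four, the growth
    factor of the levels.\<close>
  define G where "G = l div 2 - 1"
  have l: "l = 2 * Suc G \<or> l = 2 * Suc G + 1" using assms unfolding G_def by presburger
  \<comment> \<open>The constant comes from \<open>2 * 39 \<le> 39 * l\<close>; halved, it exceeds
    the difference of 11 that the port count requires.\<close>
  have "9 * (l\<^sup>2 - l) + 2 * 39 \<le> 9 * l\<^sup>2 + 39 * l" using assms by simp
  moreover have "Suc (k div 2 + 18) < m div 2 + 8" if "k + 2 * 39 \<le> m" for k m :: nat
    using that by linarith
  ultimately have "Suc M < n" unfolding M_def n_def by blast
  \<comment> \<open>Equality holds for odd \<open>l\<close>. For a given \<open>G\<close>, odd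
    \<open>l\<close> is thus the critical case for the capacity, and even \<open>l\<close> for the
    number of lines.\<close>
  have "2 ^ (l - 1) \<le> (2::nat) ^ (2 * Suc G)" using l by (intro power_increasing) auto
  also have "(2::nat) ^ (2 * Suc G) = 4 ^ Suc G" unfolding power_mult by simp
  finally have cap: "B \<le> 2 * (thr (Suc G) - 1)"
    using thr_capacity[of G] unfolding B_def by linarith
  have "2 * (15 * G * Suc G + 10 * Suc G) \<le> 9 * (l\<^sup>2 - l) + 2 * 18"
    using l by (auto simp: power2_eq_square algebra_simps)
  moreover have "k \<le> m div 2 + 18" if "2 * k \<le> m + 2 * 18" for k m :: nat using that by linarith
  ultimately have "15 * G * Suc G + 10 * Suc G \<le> M" unfolding M_def by blast
  then have "card (keys G) \<le> M" using card_keys[of G] by (rule le_trans[rotated])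
  \<comment> \<open>Lines outside the range of \<open>enc\<close> fill up the prescribed number; no
    packet is sent to them.\<close>
  then obtain enc where enc: "inj_on enc (keys G)" "enc ` keys G \<subseteq> {..<M}"
    using inj_on_iff_card_le[OF finite_keys, of "{..<M}" G] by auto
  define dl where "dl = delay \<circ> the_inv_into (keys G) enc"
  have "dl (enc k) = delay k" if "k \<in> keys G" for k
    using that enc(1) by (simp add: dl_def the_inv_into_f_f)
  then have "is_priority_queue (feedback_net n M dl) (controller n M enc B) B"
    using is_priority_queue_feedback_net cap \<open>Suc M < n\<close> enc by blast
  then show ?thesis
    using wf_feedback_net[OF \<open>Suc M < n\<close>] valid_controller
    unfolding B_def[symmetric] n_def[symmetric] M_def[symmetric]
    by (intro exI[of _ "feedback_net n M dl"] exI[of _ "controller n M enc B"]) simp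
qed

end
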